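(* Let $X$ be a graph (simple, reflexive, possibly infinite) and let $\mathrm{Id}_{\mathbf{KR}}:|\mathbf K(X)|\to\mathbf R(X)$ be the (continuous) identity map on underlying sets. For every $n\ge 0$, every continuous map $f:S^n\to\mathbf R(X)$ is homotopic to $\mathrm{Id}_{\mathbf{KR}}\circ g$ for some continuous map $g:S^n\to|\mathbf K(X)|$. Consequently, $\pi_n(\mathrm{Id}_{\mathbf{KR}}):\pi_n(|\mathbf K(X)|,* )\to\pi_n(\mathbf R(X),* )$ is an epimorphism (for $n=0$: surjective).
   Context: Pretopological spaces. A pretopological space is a set $Z$ with, for each $z\in Z$, a filter $\mathcal U_z$ on $Z$ (the neighborhood filter) all of whose members contain $z$; a filter converges to $z$ iff it contains $\mathcal U_z$. A map $f:Z\to W$ is continuous iff $\mathcal U_{f(z)}\subset f(\mathcal U_z)$ for all $z$, where $f(\mathcal U_z)$ is the filter generated by images. Topological spaces are pretopological via their neighborhood filters. In a product a filter converges iff both projections converge. Continuous $f,g:Z\to W$ are homotopic if there is a continuous $H:Z\times[0,1]\to W$ with $H(\cdot,0)=f$, $H(\cdot,1)=g$. $\pi_n(Z,* )$ is the set of based homotopy classes of continuous based maps $(S^n,* )\to(Z,* )$, a group for $n\ge1$ with the usual operation. Graphs. A graph $(X,E)$ is undirected, without multiple edges, and reflexive. The clique complex $\mathbf K(X)$ has as simplices the finite nonempty sets of pairwise adjacent vertices; $|\mathbf K(X)|$ is its geometric realization with the usual (weak) topology, with underlying set $\mathrm U|X|\supset X$; $|\sigma|$ denotes the closed geometric simplex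 of $\sigma$. The intermediate geometric realization $\mathbf R(X)$ is the pretopological space on the set $\mathrm U|X|$ where the neighborhood filter at a vertex $v\in X$ is the filter of all supersets of $\bigcup\{|\sigma| : \sigma\in\mathbf K(X),\ v\in\sigma\}$, and the neighborhood filter at a point of $\mathrm U|X|\setminus X$ is its neighborhood filter in $|\mathbf K(X)|$. The identity map on $\mathrm U|X|$ is continuous as a map $|\mathbf K(X)|\to\mathbf R(X)$. Base points are the same point of $\mathrm U|X|$ on both sides. *)

theory Defs
  imports "HOL-Analysis.Analysis" "HOL-Algebra.Group"
begin

section \<open>Pretopological spaces\<close>

text \<open>
  A filter \<open>\<U>\<close> on the set \<open>Z\<close> is represented by the library filter \<open>F\<close> on the ambient type
  with \<open>eventually (\<lambda>x. x \<in> S) F \<longleftrightarrow> S \<inter> Z \<in> \<U>\<close>; in particular \<open>F\<close> contains \<open>Z\<close> itself. Recall that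
  \<open>F \<le> G\<close> in the library means that \<open>F\<close> has at least the members of \<open>G\<close>.
\<close>

record 'a pretop =
  points :: "'a set"
  nhood :: "'a \<Rightarrow> 'a filter"

definition is_pretop :: "'a pretop \<Rightarrow> bool" where
  "is_pretop Z \<longleftrightarrow> (\<forall>z\<in>points Z. eventually (\<lambda>x. x \<in> points Z) (nhood Z z) \<and>
     (\<forall>S. eventually (\<lambda>x. x \<in> S) (nhood Z z) \<longrightarrow> z \<in> S))"

definition pcontinuous :: "'a pretop \<Rightarrow> 'b pretop \<Rightarrow> ('a \<Rightarrow> 'b) \<Rightarrow> bool" where
  "pcontinuous Z W f \<longleftrightarrow> f \<in> points Z \<rightarrow> points W \<and>
     (\<forall>z\<in>points Z. filtermap f (nhood Z z) \<le> nhood W (f z))"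

definition pretop_of :: "'a topology \<Rightarrow> 'a pretop" where
  "pretop_of T = \<lparr>points = topspace T, nhood = nhdsin T\<rparr>"

definition prod_pretop :: "'a pretop \<Rightarrow> 'b pretop \<Rightarrow> ('a \<times> 'b) pretop" where
  "prod_pretop Z W = \<lparr>points = points Z \<times> points W,
     nhood = (\<lambda>(z, w). nhood Z z \<times>\<^sub>F nhood W w)\<rparr>"

abbreviation unit_interval :: "real pretop" where
  "unit_interval \<equiv> pretop_of (top_of_set {0..1})"

lemma is_pretop_pretop_of: "is_pretop (pretop_of T)"
  by (auto simp: is_pretop_def pretop_of_def eventually_nhdsin)

lemma pcontinuous_pretop_of_iff:
  "pcontinuous (pretop_of S) (pretop_of T) f \<longleftrightarrow> continuous_map S T f"
proof -
  have *: "(\<forall>x\<in>topspace S. filtermap f (nhdsin S x) \<le> nhdsin T (f x)) \<longleftrightarrow>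
      (\<forall>U. openin T U \<longrightarrow> openin S {x \<in> topspace S. f x \<in> U})" (is "?L \<longleftrightarrow> ?R")
    if f: "f \<in> topspace S \<rightarrow> topspace T"
  proof
    assume L: ?L
    show ?R
    proof (intro allI impI)
      fix U assume U: "openin T U"
      have "\<exists>V. openin S V \<and> x \<in> V \<and> V \<subseteq> {x \<in> topspace S. f x \<in> U}"
        if x: "x \<in> topspace S" "f x \<in> U" for x
      proof -
        have "eventually (\<lambda>y. y \<in> U) (nhdsin T (f x))"
          unfolding eventually_nhdsin using U x(2) by blast
        then have "eventually (\<lambda>y. f y \<in> U) (nhdsin S x)"
          using L x(1) unfolding le_filter_def eventually_filtermap by blast
        then obtain V where "openin S V" "x \<in> V" "\<forall>y\<in>V. f y \<in> U"
          unfolding eventually_nhdsin using x(1) by blast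
        then show ?thesis
          using openin_subset by blast
      qed
      then show "openin S {x \<in> topspace S. f x \<in> U}"
        by (subst openin_subopen) blast
    qed
  next
    assume R: ?R
    show ?L
      unfolding le_filter_def eventually_filtermap
    proof (intro ballI allI impI)
      fix x P assume x: "x \<in> topspace S" and "eventually P (nhdsin T (f x))"
      moreover have fx: "f x \<in> topspace T"
        using x f by blast
      ultimately obtain U where U: "openin T U" "f x \<in> U" "\<forall>y\<in>U. P y"
        unfolding eventually_nhdsin by blast
      have "openin S {x \<in> topspace S. f x \<in> U}"
        using R U(1) by blast
      then show "eventually (\<lambda>y. P (f y)) (nhdsin S x)"
        unfolding eventually_nhdsin using x U by blast
    qed
  qed
  show ?thesis
    unfolding pcontinuous_def pretop_of_def continuous_map_def using * by auto
qed

text \<open>A filter converges in the product iff both of its projections converge.\<close>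

lemma le_nhood_prod_pretop_iff:
  "F \<le> nhood (prod_pretop Z W) (z, w) \<longleftrightarrow>
     filtermap fst F \<le> nhood Z z \<and> filtermap snd F \<le> nhood W w"
proof
  assume *: "F \<le> nhood (prod_pretop Z W) (z, w)"
  then have "F \<le> nhood Z z \<times>\<^sub>F nhood W w"
    by (simp add: prod_pretop_def)
  then show "filtermap fst F \<le> nhood Z z \<and> filtermap snd F \<le> nhood W w"
    by (meson filtermap_fst_prod_filter filtermap_mono filtermap_snd_prod_filter order_trans)
next
  assume "filtermap fst F \<le> nhood Z z \<and> filtermap snd F \<le> nhood W w"
  then show "F \<le> nhood (prod_pretop Z W) (z, w)"
    by (auto simp: prod_pretop_def intro: le_prod_filterI)
qed

section \<open>Homotopy\<close>

definition phomotopic :: "'a pretop \<Rightarrow> 'b pretop \<Rightarrow> ('a \<Rightarrow> 'b) \<Rightarrow> ('a \<Rightarrow> 'b) \<Rightarrow> bool" where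
  "phomotopic Z W f g \<longleftrightarrow> pcontinuous Z W f \<and> pcontinuous Z W g \<and>
     (\<exists>H. pcontinuous (prod_pretop Z unit_interval) W H \<and>
        (\<forall>x\<in>points Z. H (x, 0) = f x \<and> H (x, 1) = g x))"

abbreviation Sphere :: "nat \<Rightarrow> (nat \<Rightarrow> real) pretop" where
  "Sphere n \<equiv> pretop_of (nsphere n)"

definition sphere_base :: "nat \<Rightarrow> real" where
  "sphere_base = (\<lambda>i. if i = 0 then 1 else 0)"

definition based_maps :: "nat \<Rightarrow> 'b pretop \<Rightarrow> 'b \<Rightarrow> ((nat \<Rightarrow> real) \<Rightarrow> 'b) set" where
  "based_maps n Z z = {f. pcontinuous (Sphere n) Z f \<and> f sphere_base = z}"

text \<open>
  Maps are total functions on the ambient type, whose values off the sphere are irrelevant;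
  this relation identifies maps that agree on the sphere.
\<close>

definition based_homotopy_rel ::
    "nat \<Rightarrow> 'b pretop \<Rightarrow> 'b \<Rightarrow> (((nat \<Rightarrow> real) \<Rightarrow> 'b) \<times> ((nat \<Rightarrow> real) \<Rightarrow> 'b)) set" where
  "based_homotopy_rel n Z z = {(f, g). f \<in> based_maps n Z z \<and> g \<in> based_maps n Z z \<and>
     (\<exists>H. pcontinuous (prod_pretop (Sphere n) unit_interval) Z H \<and>
        (\<forall>x\<in>points (Sphere n). H (x, 0) = f x \<and> H (x, 1) = g x) \<and>
        (\<forall>t\<in>{0..1}. H (sphere_base, t) = z))}"

text \<open>
  For \<open>n \<ge> 1\<close>, the sphere is the reduced suspension of its equator \<open>{x. x n = 0}\<close>: the
  suspension circle through an equatorial point \<open>w\<close> has the segment from the base point to \<open>w\<close>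
  as a diameter and otherwise runs in the direction of the last coordinate. It is traversed from
  the base point (angle \<open>0\<close>) through the upper hemisphere to \<open>w\<close> (angle \<open>pi\<close>) and back
  through the lower hemisphere.
\<close>

definition susp_circle :: "nat \<Rightarrow> (nat \<Rightarrow> real) \<Rightarrow> real \<Rightarrow> nat \<Rightarrow> real" where
  "susp_circle n w \<theta> = (\<lambda>i. (sphere_base i + w i) / 2 + cos \<theta> * ((sphere_base i - w i) / 2)
     + (if i = n then sin \<theta> * sqrt ((1 - w 0) / 2) else 0))"

text \<open>
  The pinch map doubles the angle on every suspension circle. It collapses the equator to the
  base point and maps each hemisphere modulo the equator bijectively, with degree \<open>1\<close>, to the
  sphere. Division by zero makes the formula correct at the base point.
\<close>

definition pinch :: "nat \<Rightarrow> (nat \<Rightarrow> real) \<Rightarrow> nat \<Rightarrow> real" where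
  "pinch n x = (\<lambda>i. sphere_base i + 2 * ((x n)\<^sup>2 / (1 - x 0)) * (x i - sphere_base i)
     - (if i = n then 2 * x n else 0))"

lemma pinch_susp_circle:
  assumes "n \<ge> 1" "w \<in> topspace (nsphere n)" "w n = 0"
  shows "pinch n (susp_circle n w \<theta>) = susp_circle n w (2 * \<theta>)"
proof -
  define r where "r = sqrt ((1 - w 0) / 2)"
  define x where "x = susp_circle n w \<theta>"
  have le1: "(w 0)\<^sup>2 + (w i)\<^sup>2 \<le> 1" if "0 < i" for i
  proof (cases "i \<le> n")
    case True
    have "(\<Sum>j\<in>{0, i}. (w j)\<^sup>2) \<le> (\<Sum>j\<le>n. (w j)\<^sup>2)"
      using True by (intro sum_mono2) auto
    then show ?thesis using that assms(2) by (auto simp: nsphere)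
  next
    case False
    have "(\<Sum>j\<in>{0}. (w j)\<^sup>2) \<le> (\<Sum>j\<le>n. (w j)\<^sup>2)"
      by (intro sum_mono2) auto
    then show ?thesis using False assms(2) by (auto simp: nsphere)
  qed
  have "(w 0)\<^sup>2 \<le> 1"
    using le1[of 1] by (smt (verit) zero_le_power2 zero_less_one)
  then have "w 0 \<le> 1"
    using abs_square_le_1[of "w 0"] by linarith
  then have r2: "r\<^sup>2 = (1 - w 0) / 2"
    by (simp add: r_def)
  have xn: "x n = r * sin \<theta>"
    using assms(1,3) by (simp add: x_def susp_circle_def sphere_base_def r_def)
  have x0: "1 - x 0 = r\<^sup>2 * (1 - cos \<theta>)"
    using assms(1) unfolding r2 by (simp add: x_def susp_circle_def sphere_base_def field_simps)
  show ?thesis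
  proof (cases "r = 0 \<or> cos \<theta> = 1")
    case False
    have "(x n)\<^sup>2 / (1 - x 0) = (sin \<theta>)\<^sup>2 / (1 - cos \<theta>)"
      using False by (simp add: xn x0 power_mult_distrib)
    also have "\<dots> = 1 + cos \<theta>"
      using False by (simp add: sin_squared_eq field_simps power2_eq_square)
    finally have a: "(x n)\<^sup>2 / (1 - x 0) = 1 + cos \<theta>" .
    have "pinch n x i = susp_circle n w (2 * \<theta>) i" for i
    proof -
      have "pinch n x i = sphere_base i + 2 * (1 + cos \<theta>) * (x i - sphere_base i)
          - (if i = n then 2 * x n else 0)"
        by (simp add: pinch_def a)
      moreover have "cos (2 * \<theta>) = 2 * (cos \<theta>)\<^sup>2 - 1" "sin (2 * \<theta>) = 2 * sin \<theta> * cos \<theta>"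
        by (simp_all add: cos_double_cos sin_double)
      moreover have "x i = (sphere_base i + w i) / 2 + cos \<theta> * ((sphere_base i - w i) / 2)
          + (if i = n then r * sin \<theta> else 0)" for i
        by (simp add: x_def susp_circle_def r_def)
      moreover have "sphere_base n = 0"
        using assms(1) by (simp add: sphere_base_def)
      moreover have "b + 2 * (1 + c) * (((b + v) / 2 + c * ((b - v) / 2)) - b) =
          (b + v) / 2 + (2 * c\<^sup>2 - 1) * ((b - v) / 2)" for b c v :: real
        by (simp add: field_simps power2_eq_square)
      moreover have "2 * (1 + c) * y - 2 * y = 2 * c * y" for c y :: real
        by (simp add: algebra_simps)
      ultimately show ?thesis
        using assms(3) by (cases "i = n") (simp_all add: susp_circle_def r_def[symmetric])
    qed
    then show ?thesis unfolding x_def by blast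
  next
    case True
    have "x = sphere_base \<and> susp_circle n w (2 * \<theta>) = sphere_base"
    proof (cases "r = 0")
      case True
      then have "w 0 = 1" using r2 by simp
      then have "w i = 0" if "i > 0" for i
        using le1[OF that] by simp
      then have "w = sphere_base"
        using \<open>w 0 = 1\<close> by (auto simp: sphere_base_def fun_eq_iff)
      then show ?thesis
        using True by (auto simp: x_def susp_circle_def r_def sphere_base_def fun_eq_iff)
    next
      case False
      with True have c: "cos \<theta> = 1" by simp
      then have s: "sin \<theta> = 0"
        by (metis sin_cos_squared_add add_cancel_left_left power_one zero_eq_power2)
      show ?thesis
        unfolding x_def susp_circle_def cos_double_cos sin_double c s
        by (simp add: fun_eq_iff field_simps)
    qed
    moreover have "pinch n sphere_base = sphere_base"
      using assms(1) by (auto simp: pinch_def sphere_base_def fun_eq_iff)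
    ultimately show ?thesis unfolding x_def by simp
  qed
qed

text \<open>For \<open>n = 1\<close> this is the usual concatenation of loops, \<open>f\<close> first.\<close>

definition sphere_concat ::
    "nat \<Rightarrow> ((nat \<Rightarrow> real) \<Rightarrow> 'b) \<Rightarrow> ((nat \<Rightarrow> real) \<Rightarrow> 'b) \<Rightarrow> (nat \<Rightarrow> real) \<Rightarrow> 'b" where
  "sphere_concat n f g = (\<lambda>x. if x n \<ge> 0 then f (pinch n x) else g (pinch n x))"

definition homotopy_set :: "nat \<Rightarrow> 'b pretop \<Rightarrow> 'b \<Rightarrow> ((nat \<Rightarrow> real) \<Rightarrow> 'b) set set" where
  "homotopy_set n Z z = based_maps n Z z // based_homotopy_rel n Z z"

text \<open>The operation is meaningful for \<open>n \<ge> 1\<close> only.\<close>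

definition homotopy_group :: "nat \<Rightarrow> 'b pretop \<Rightarrow> 'b \<Rightarrow> ((nat \<Rightarrow> real) \<Rightarrow> 'b) set monoid" where
  "homotopy_group n Z z = \<lparr>carrier = homotopy_set n Z z,
     mult = (\<lambda>A B. based_homotopy_rel n Z z `` {sphere_concat n f g | f g. f \<in> A \<and> g \<in> B}),
     one = based_homotopy_rel n Z z `` {\<lambda>_. z}\<rparr>"

text \<open>The map induced on homotopy classes by a based map \<open>h\<close> into \<open>(W, w)\<close>.\<close>

definition homotopy_map :: "nat \<Rightarrow> 'c pretop \<Rightarrow> 'c \<Rightarrow> ('b \<Rightarrow> 'c) \<Rightarrow>
    ((nat \<Rightarrow> real) \<Rightarrow> 'b) set \<Rightarrow> ((nat \<Rightarrow> real) \<Rightarrow> 'c) set" where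
  "homotopy_map n W w h A = based_homotopy_rel n W w `` ((\<lambda>f. h \<circ> f) ` A)"

section \<open>Graphs and their realizations\<close>

definition reflexive_graph :: "'a set \<Rightarrow> ('a \<times> 'a) set \<Rightarrow> bool" where
  "reflexive_graph X E \<longleftrightarrow> E \<subseteq> X \<times> X \<and> refl_on X E \<and> sym E"

definition clique_complex :: "'a set \<Rightarrow> ('a \<times> 'a) set \<Rightarrow> 'a set set" where
  "clique_complex X E =
     {\<sigma>. finite \<sigma> \<and> \<sigma> \<noteq> {} \<and> \<sigma> \<subseteq> X \<and> (\<forall>u\<in>\<sigma>. \<forall>v\<in>\<sigma>. (u, v) \<in> E)}"

text \<open>
  Points of a realization are given by their barycentric coordinates; the vertex \<open>v\<close> is the
  point \<open>indicator {v}\<close>.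
\<close>

definition geom_simplex :: "'a set \<Rightarrow> ('a \<Rightarrow> real) set" where
  "geom_simplex \<sigma> = {t. (\<forall>v. 0 \<le> t v) \<and> (\<forall>v. v \<notin> \<sigma> \<longrightarrow> t v = 0) \<and> (\<Sum>v\<in>\<sigma>. t v) = 1}"

definition geom_points :: "'a set set \<Rightarrow> ('a \<Rightarrow> real) set" where
  "geom_points K = (\<Union>\<sigma>\<in>K. geom_simplex \<sigma>)"

text \<open>
  The weak topology. The function type carries the product topology, which induces the
  Euclidean topology on each simplex, since simplices are finite.
\<close>

definition geom_realization :: "'a set set \<Rightarrow> ('a \<Rightarrow> real) topology" where
  "geom_realization K = topology (\<lambda>U. U \<subseteq> geom_points K \<and>
     (\<forall>\<sigma>\<in>K. openin (top_of_set (geom_simplex \<sigma>)) (U \<inter> geom_simplex \<sigma>)))"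

lemma openin_geom_realization:
  "openin (geom_realization K) U \<longleftrightarrow> U \<subseteq> geom_points K \<and>
     (\<forall>\<sigma>\<in>K. openin (top_of_set (geom_simplex \<sigma>)) (U \<inter> geom_simplex \<sigma>))"
proof -
  let ?P = "\<lambda>U. U \<subseteq> geom_points K \<and>
     (\<forall>\<sigma>\<in>K. openin (top_of_set (geom_simplex \<sigma>)) (U \<inter> geom_simplex \<sigma>))"
  have "istopology ?P"
    unfolding istopology_def
  proof (intro conjI allI impI)
    fix S T assume S: "?P S" and T: "?P T"
    show "S \<inter> T \<subseteq> geom_points K" using S by auto
    show "\<forall>\<sigma>\<in>K. openin (top_of_set (geom_simplex \<sigma>)) (S \<inter> T \<inter> geom_simplex \<sigma>)"
    proof
      fix \<sigma> assume "\<sigma> \<in> K"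
      then have "openin (top_of_set (geom_simplex \<sigma>))
          ((S \<inter> geom_simplex \<sigma>) \<inter> (T \<inter> geom_simplex \<sigma>))"
        using S T by (intro openin_Int[of _ "S \<inter> _" "T \<inter> _"]) auto
      moreover have "(S \<inter> geom_simplex \<sigma>) \<inter> (T \<inter> geom_simplex \<sigma>) = S \<inter> T \<inter> geom_simplex \<sigma>"
        by blast
      ultimately show "openin (top_of_set (geom_simplex \<sigma>)) (S \<inter> T \<inter> geom_simplex \<sigma>)"
        by metis
    qed
  next
    fix \<K> assume K: "\<forall>S\<in>\<K>. ?P S"
    show "\<Union>\<K> \<subseteq> geom_points K" using K by auto
    show "\<forall>\<sigma>\<in>K. openin (top_of_set (geom_simplex \<sigma>)) (\<Union>\<K> \<inter> geom_simplex \<sigma>)"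
    proof
      fix \<sigma> assume "\<sigma> \<in> K"
      then have "openin (top_of_set (geom_simplex \<sigma>)) (\<Union>((\<lambda>S. S \<inter> geom_simplex \<sigma>) ` \<K>))"
        using K by (intro openin_Union) blast
      then show "openin (top_of_set (geom_simplex \<sigma>)) (\<Union>\<K> \<inter> geom_simplex \<sigma>)"
        by (simp only: Int_Union2)
    qed
  qed
  then show ?thesis
    by (simp add: geom_realization_def topology_inverse')
qed

lemma topspace_geom_realization: "topspace (geom_realization K) = geom_points K"
proof (rule antisym)
  show "topspace (geom_realization K) \<subseteq> geom_points K"
    using openin_geom_realization openin_topspace by blast
  have "openin (geom_realization K) (geom_points K)"
    unfolding openin_geom_realization
  proof safe
    fix \<sigma> assume "\<sigma> \<in> K"
    then have "geom_points K \<inter> geom_simplex \<sigma> = geom_simplex \<sigma>"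
      by (auto simp: geom_points_def)
    then show "openin (top_of_set (geom_simplex \<sigma>)) (geom_points K \<inter> geom_simplex \<sigma>)"
      by simp
  qed
  then show "geom_points K \<subseteq> topspace (geom_realization K)"
    by (rule openin_subset)
qed

abbreviation clique_realization :: "'a set \<Rightarrow> ('a \<times> 'a) set \<Rightarrow> ('a \<Rightarrow> real) pretop" where
  "clique_realization X E \<equiv> pretop_of (geom_realization (clique_complex X E))"

definition intermediate_realization ::
    "'a set \<Rightarrow> ('a \<times> 'a) set \<Rightarrow> ('a \<Rightarrow> real) pretop" where
  "intermediate_realization X E = \<lparr>points = geom_points (clique_complex X E),
     nhood = (\<lambda>x. if \<exists>v\<in>X. x = indicator {v}
       then principal (\<Union>{geom_simplex \<sigma> | \<sigma> v. x = indicator {v} \<and> \<sigma> \<in> clique_complex X E \<and> v \<in> \<sigma>})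
       else nhdsin (geom_realization (clique_complex X E)) x)\<rparr>"

lemma nhood_intermediate_realization_vertex:
  assumes "v \<in> X"
  shows "nhood (intermediate_realization X E) (indicator {v}) =
    principal (\<Union>{geom_simplex \<sigma> | \<sigma>. \<sigma> \<in> clique_complex X E \<and> v \<in> \<sigma>})"
proof -
  have "(indicator {v} :: 'a \<Rightarrow> real) = indicator {u} \<longleftrightarrow> u = v" for u
    by (metis indicator_eq_0_iff indicator_eq_1_iff singleton_iff zero_neq_one)
  then show ?thesis
    using assms by (auto simp: intermediate_realization_def)
qed

lemma is_pretop_intermediate_realization: "is_pretop (intermediate_realization X E)"
proof -
  let ?K = "clique_complex X E" and ?R = "intermediate_realization X E"
  have "eventually (\<lambda>x. x \<in> points ?R) (nhood ?R z) \<and>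
      (\<forall>S. eventually (\<lambda>x. x \<in> S) (nhood ?R z) \<longrightarrow> z \<in> S)" if z: "z \<in> geom_points ?K" for z
  proof (cases "\<exists>v\<in>X. z = indicator {v}")
    case True
    then obtain v where v: "v \<in> X" "z = indicator {v}" by blast
    obtain \<sigma> where \<sigma>: "\<sigma> \<in> ?K" "z \<in> geom_simplex \<sigma>"
      using z by (auto simp: geom_points_def)
    have "v \<in> \<sigma>"
    proof (rule ccontr)
      assume "v \<notin> \<sigma>"
      then have "z v = 0"
        using \<sigma>(2) by (simp add: geom_simplex_def)
      then show False
        by (simp add: v(2))
    qed
    then show ?thesis
      unfolding v(2) nhood_intermediate_realization_vertex[OF v(1)] eventually_principal
      using \<sigma> v(2) by (auto simp: intermediate_realization_def geom_points_def)
  next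
    case False
    then have "nhood ?R z = nhdsin (geom_realization ?K) z"
      by (simp add: intermediate_realization_def)
    then show ?thesis
      using is_pretop_pretop_of[of "geom_realization ?K"] z
      by (simp add: is_pretop_def pretop_of_def intermediate_realization_def
          topspace_geom_realization)
  qed
  then show ?thesis
    by (simp add: is_pretop_def intermediate_realization_def)
qed

definition Id_KR :: "('a \<Rightarrow> real) \<Rightarrow> ('a \<Rightarrow> real)" where
  "Id_KR = (\<lambda>x. x)"

lemma pcontinuous_Id_KR: "pcontinuous (clique_realization X E) (intermediate_realization X E) Id_KR"
proof -
  let ?K = "clique_complex X E" and ?R = "intermediate_realization X E"
  have "nhdsin (geom_realization ?K) z \<le> nhood ?R z" if z: "z \<in> geom_points ?K" for z
  proof (cases "\<exists>v\<in>X. z = indicator {v}")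
    case True
    then obtain v where v: "v \<in> X" "z = indicator {v}" by blast
    define U where "U = {t \<in> geom_points ?K. t v > 0}"
    have "openin (top_of_set (geom_simplex \<sigma>)) (U \<inter> geom_simplex \<sigma>)" if "\<sigma> \<in> ?K" for \<sigma>
    proof -
      have "open {t :: 'a \<Rightarrow> real. 0 < t v}"
        by (intro open_Collect_less continuous_on_const continuous_on_product_coordinates)
      moreover have "U \<inter> geom_simplex \<sigma> = geom_simplex \<sigma> \<inter> {t. 0 < t v}"
        using that by (auto simp: U_def geom_points_def)
      ultimately show ?thesis
        by (auto intro: openin_open_Int)
    qed
    then have "openin (geom_realization ?K) U"
      unfolding openin_geom_realization by (auto simp: U_def)
    moreover have "z \<in> U"
      using z by (simp add: U_def v(2))
    moreover have "U \<subseteq> \<Union>{geom_simplex \<sigma> | \<sigma>. \<sigma> \<in> ?K \<and> v \<in> \<sigma>}"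
    proof
      fix t assume "t \<in> U"
      then obtain \<sigma> where \<sigma>: "\<sigma> \<in> ?K" "t \<in> geom_simplex \<sigma>" and "t v > 0"
        by (auto simp: U_def geom_points_def)
      then have "v \<in> \<sigma>"
        by (auto simp: geom_simplex_def)
      then show "t \<in> \<Union>{geom_simplex \<sigma> | \<sigma>. \<sigma> \<in> ?K \<and> v \<in> \<sigma>}"
        using \<sigma> by blast
    qed
    ultimately have "eventually (\<lambda>t. t \<in> \<Union>{geom_simplex \<sigma> | \<sigma>. \<sigma> \<in> ?K \<and> v \<in> \<sigma>})
        (nhdsin (geom_realization ?K) z)"
      unfolding eventually_nhdsin by (meson subsetD)
    then show ?thesis
      unfolding v(2) nhood_intermediate_realization_vertex[OF v(1)] le_principal .
  next
    case False
    then show ?thesis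
      by (simp add: intermediate_realization_def)
  qed
  then show ?thesis
    by (simp add: pcontinuous_def pretop_of_def intermediate_realization_def Id_KR_def
        topspace_geom_realization filtermap_ident)
qed

end

theory Submission
  imports Defs
begin

text \<open>
  Every point \<open>x\<close> of the sphere has a ball of some radius \<open>2 r\<^sub>x\<close> which \<open>f\<close> maps into the closed
  star of a vertex \<open>v\<^sub>x\<close> of the carrier of \<open>f x\<close>. Cover the sphere by finitely many of the balls
  of radius \<open>r\<^sub>a\<close>, and let \<open>g\<close> be the combination of the vertices \<open>v\<^sub>a\<close> by a subordinate
  partition of unity. The doubled radii make the vertices that are active at \<open>x\<close> a clique
  together with the carrier of \<open>f x\<close>, so \<open>g\<close> is a continuous map into the clique complex.
  If \<open>h x\<close> is one of the active vertices, then the map that is \<open>f x\<close> for \<open>t < 1/2\<close>, \<open>h x\<close> for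
  \<open>t = 1/2\<close> and \<open>g x\<close> for \<open>t > 1/2\<close> is a continuous homotopy, since all nearby values lie in the
  closed star of the vertex \<open>h x\<close>, which is a neighborhood in the intermediate realization.

  For based maps, choose the cover such that only one ball contains the base point; this
  suffices if \<open>f\<close> maps the base point to a vertex. Otherwise \<open>f\<close> is continuous into the clique
  complex near the base point, and there the jump is replaced by a linear homotopy from \<open>f\<close>
  that leaves the base point fixed.
\<close>

section \<open>Maps from topological into pretopological spaces\<close>

lemma points_pretop_of [simp]: "points (pretop_of T) = topspace T"
  by (simp add: pretop_of_def)

lemma nhood_pretop_of [simp]: "nhood (pretop_of T) = nhdsin T"
  by (simp add: pretop_of_def)

text \<open>Both filters are generated by the open boxes around the point. Homotopies thereby become
  maps out of an ordinary topological cylinder, whose continuity can be tested on open sets.\<close>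

lemma prod_pretop_of: "prod_pretop (pretop_of S) (pretop_of T) = pretop_of (prod_topology S T)"
proof -
  have "nhdsin S x \<times>\<^sub>F nhdsin T y = nhdsin (prod_topology S T) (x, y)" for x y
  proof (rule filter_eq_iff[THEN iffD2], intro allI)
    fix P
    show "eventually P (nhdsin S x \<times>\<^sub>F nhdsin T y) \<longleftrightarrow>
        eventually P (nhdsin (prod_topology S T) (x, y))"
    proof (cases "x \<in> topspace S \<and> y \<in> topspace T")
      case True
      show ?thesis
      proof
        assume "eventually P (nhdsin S x \<times>\<^sub>F nhdsin T y)"
        then obtain Pf Pg where *: "eventually Pf (nhdsin S x)" "eventually Pg (nhdsin T y)"
            "\<forall>x y. Pf x \<longrightarrow> Pg y \<longrightarrow> P (x, y)"
          unfolding eventually_prod_filter by blast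
        obtain U V where "openin S U" "x \<in> U" "\<forall>x\<in>U. Pf x" "openin T V" "y \<in> V" "\<forall>y\<in>V. Pg y"
          using *(1,2) True unfolding eventually_nhdsin by blast
        then have "openin (prod_topology S T) (U \<times> V) \<and> (x, y) \<in> U \<times> V \<and> (\<forall>z\<in>U \<times> V. P z)"
          using *(3) by (auto simp: openin_prod_Times_iff)
        then show "eventually P (nhdsin (prod_topology S T) (x, y))"
          unfolding eventually_nhdsin by blast
      next
        assume "eventually P (nhdsin (prod_topology S T) (x, y))"
        then obtain W where W: "openin (prod_topology S T) W" "(x, y) \<in> W" "\<forall>z\<in>W. P z"
          using True unfolding eventually_nhdsin by auto
        then obtain U V where "openin S U" "openin T V" "x \<in> U" "y \<in> V" "U \<times> V \<subseteq> W"
          unfolding openin_prod_topology_alt by metis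
        then have "eventually (\<lambda>x. x \<in> U) (nhdsin S x)" "eventually (\<lambda>y. y \<in> V) (nhdsin T y)"
            "\<forall>x y. x \<in> U \<longrightarrow> y \<in> V \<longrightarrow> P (x, y)"
          using W(3) by (auto simp: eventually_nhdsin)
        then show "eventually P (nhdsin S x \<times>\<^sub>F nhdsin T y)"
          unfolding eventually_prod_filter by blast
      qed
    next
      \<comment> \<open>Off the space \<open>nhdsin\<close> is the bottom filter, so both sides hold
        for every \<open>P\<close>.\<close>
      case False
      then show ?thesis
        by (auto simp: eventually_prod_filter eventually_nhdsin)
    qed
  qed
  then show ?thesis
    by (simp add: prod_pretop_def pretop_of_def fun_eq_iff)
qed

lemma pcontinuous_from_topology:
  "pcontinuous (pretop_of T) W f \<longleftrightarrow> f \<in> topspace T \<rightarrow> points W \<and>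
     (\<forall>x\<in>topspace T. \<forall>P. eventually P (nhood W (f x)) \<longrightarrow>
        (\<exists>U. openin T U \<and> x \<in> U \<and> (\<forall>y\<in>U. P (f y))))"
  unfolding pcontinuous_def le_filter_def eventually_filtermap
  by (auto simp: eventually_nhdsin)

lemma pcontinuous_compose:
  assumes "pcontinuous Y Z f" "pcontinuous Z W g"
  shows "pcontinuous Y W (g \<circ> f)"
  unfolding pcontinuous_def
proof (intro conjI ballI)
  show "g \<circ> f \<in> points Y \<rightarrow> points W"
    using assms by (auto simp: pcontinuous_def)
  fix y assume y: "y \<in> points Y"
  have "filtermap g (filtermap f (nhood Y y)) \<le> filtermap g (nhood Z (f y))"
    using assms(1) y by (intro filtermap_mono) (auto simp: pcontinuous_def)
  also have "\<dots> \<le> nhood W (g (f y))"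
    using assms y by (auto simp: pcontinuous_def)
  finally show "filtermap (g \<circ> f) (nhood Y y) \<le> nhood W ((g \<circ> f) y)"
    by (simp add: filtermap_filtermap o_def)
qed

lemma pcontinuous_compose_map:
  assumes "continuous_map S T k" "pcontinuous (pretop_of T) W f"
  shows "pcontinuous (pretop_of S) W (f \<circ> k)"
  using assms pcontinuous_compose pcontinuous_pretop_of_iff by blast

lemma pcontinuous_eq:
  assumes "pcontinuous (pretop_of T) W f" "\<And>x. x \<in> topspace T \<Longrightarrow> f x = g x"
  shows "pcontinuous (pretop_of T) W g"
  using assms unfolding pcontinuous_from_topology
  by (smt (verit) Pi_iff openin_subset subsetD)

lemma pcontinuous_subtopology:
  assumes "pcontinuous (pretop_of T) W f"
  shows "pcontinuous (pretop_of (subtopology T A)) W f"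
proof -
  have "pcontinuous (pretop_of (subtopology T A)) W (f \<circ> id)"
    by (rule pcontinuous_compose_map[OF _ assms]) (simp add: continuous_map_from_subtopology)
  then show ?thesis by simp
qed

text \<open>Continuity at a point depends only on the map near it, so a map given by different
  formulas on different regions can be checked one region at a time.\<close>

lemma pcontinuous_at_locally:
  assumes U: "openin T U" "x \<in> U" and f': "pcontinuous (pretop_of (subtopology T U)) W f'"
    and eq: "\<And>y. y \<in> U \<Longrightarrow> f y = f' y" and P: "eventually P (nhood W (f x))"
  shows "\<exists>V. openin T V \<and> x \<in> V \<and> (\<forall>y\<in>V. P (f y))"
proof -
  have "x \<in> topspace (subtopology T U)" "eventually P (nhood W (f' x))"
    using U openin_subset[OF U(1)] eq P by auto
  then obtain V where "openin (subtopology T U) V" "x \<in> V" "\<forall>y\<in>V. P (f' y)"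
    using f' unfolding pcontinuous_from_topology by blast
  moreover from this have "openin T V" "V \<subseteq> U"
    using U(1) openin_open_subtopology by blast+
  ultimately show ?thesis
    using eq by (metis subsetD)
qed

text \<open>Each closed piece yields an open set on which the points of that piece behave well; the
  intersection of the two open sets then works because the pieces cover the space.\<close>

lemma pcontinuous_pasting:
  assumes A: "closedin T A" and B: "closedin T B" and AB: "topspace T \<subseteq> A \<union> B"
    and f: "pcontinuous (pretop_of (subtopology T A)) W f"
    and g: "pcontinuous (pretop_of (subtopology T B)) W g"
    and eq: "\<And>x. x \<in> A \<Longrightarrow> x \<in> B \<Longrightarrow> f x = g x"
  shows "pcontinuous (pretop_of T) W (\<lambda>x. if x \<in> A then f x else g x)"
  unfolding pcontinuous_from_topology
proof (intro conjI ballI allI impI)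
  let ?h = "\<lambda>x. if x \<in> A then f x else g x"
  show "?h \<in> topspace T \<rightarrow> points W"
    using f g AB by (fastforce simp: pcontinuous_from_topology)
  \<comment> \<open>If \<open>x\<close> lies outside the closed piece, the complement of the piece
    is an open set on which the condition is vacuous.\<close>
  have *: "\<exists>U. openin T U \<and> x \<in> U \<and> (\<forall>y\<in>U \<inter> C. P (k y))"
    if x: "x \<in> topspace T" and C: "closedin T C" and k: "pcontinuous (pretop_of (subtopology T C)) W k"
      and P: "x \<in> C \<Longrightarrow> eventually P (nhood W (k x))" for x C P k
  proof (cases "x \<in> C")
    case True
    then obtain V where V: "openin (subtopology T C) V" "x \<in> V" "\<forall>y\<in>V. P (k y)"
      using k P x unfolding pcontinuous_from_topology by (metis IntI topspace_subtopology)
    then obtain U where "openin T U" "V = U \<inter> C"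
      unfolding openin_subtopology by blast
    with V show ?thesis by blast
  next
    case False
    then show ?thesis
      using x C by (intro exI[of _ "topspace T - C"]) auto
  qed
  fix x P assume x: "x \<in> topspace T" and P: "eventually P (nhood W (?h x))"
  obtain U where U: "openin T U" "x \<in> U" "\<forall>y\<in>U \<inter> A. P (f y)"
    using *[OF x A f, of P] P by (auto split: if_splits)
  obtain V where V: "openin T V" "x \<in> V" "\<forall>y\<in>V \<inter> B. P (g y)"
    using *[OF x B g, of P] P eq[of x] by (metis (full_types))
  have "openin T (U \<inter> V) \<and> x \<in> U \<inter> V \<and> (\<forall>y\<in>U \<inter> V. P (?h y))"
    using U V AB openin_subset by fastforce
  then show "\<exists>U. openin T U \<and> x \<in> U \<and> (\<forall>y\<in>U. P (?h y))" by blast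
qed

section \<open>Based homotopy\<close>

lemma based_mapsD:
  "f \<in> based_maps n Z z \<Longrightarrow> pcontinuous (Sphere n) Z f"
  "f \<in> based_maps n Z z \<Longrightarrow> f sphere_base = z"
  by (auto simp: based_maps_def)

lemma sphere_base_in_nsphere: "sphere_base \<in> topspace (nsphere n)"
  using in_topspace_nsphere by (simp add: sphere_base_def)

abbreviation cylinder :: "nat \<Rightarrow> ((nat \<Rightarrow> real) \<times> real) topology" where
  "cylinder n \<equiv> prod_topology (nsphere n) (top_of_set {0..1})"

text \<open>That \<open>f\<close> and \<open>g\<close> are based maps is read off from the two ends
  of the cylinder, so only \<open>H\<close> has to be examined.\<close>

lemma based_homotopyI:
  assumes "pcontinuous (pretop_of (cylinder n)) Z H"
    and "\<And>x. x \<in> topspace (nsphere n) \<Longrightarrow> H (x, 0) = f x"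
    and "\<And>x. x \<in> topspace (nsphere n) \<Longrightarrow> H (x, 1) = g x"
    and b: "\<And>t. t \<in> {0..1} \<Longrightarrow> H (sphere_base, t) = z"
  shows "(f, g) \<in> based_homotopy_rel n Z z"
proof -
  have "pcontinuous (Sphere n) Z (H \<circ> (\<lambda>x. (x, t)))" if "t \<in> {0..1}" for t
    using that by (intro pcontinuous_compose_map[OF _ assms(1)])
      (auto simp: continuous_map_pairwise o_def)
  from this[of 0] this[of 1] have "pcontinuous (Sphere n) Z f" "pcontinuous (Sphere n) Z g"
    using assms(2,3) by (auto intro: pcontinuous_eq[of _ _ "H \<circ> (\<lambda>x. (x, 0))"]
      pcontinuous_eq[of _ _ "H \<circ> (\<lambda>x. (x, 1))"])
  moreover have "f sphere_base = z" "g sphere_base = z"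
    using assms(2,3) b[of 0] b[of 1] sphere_base_in_nsphere by force+
  ultimately show ?thesis
    using assms by (auto simp: based_homotopy_rel_def based_maps_def prod_pretop_of)
qed

lemma based_homotopyE:
  assumes "(f, g) \<in> based_homotopy_rel n Z z"
  obtains H where "pcontinuous (pretop_of (cylinder n)) Z H"
    "\<And>x. x \<in> topspace (nsphere n) \<Longrightarrow> H (x, 0) = f x"
    "\<And>x. x \<in> topspace (nsphere n) \<Longrightarrow> H (x, 1) = g x"
    "\<And>t. t \<in> {0..1} \<Longrightarrow> H (sphere_base, t) = z"
  using assms unfolding based_homotopy_rel_def prod_pretop_of points_pretop_of by blast

lemma based_homotopy_sym:
  assumes "(f, g) \<in> based_homotopy_rel n Z z"
  shows "(g, f) \<in> based_homotopy_rel n Z z"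
proof -
  obtain H where H: "pcontinuous (pretop_of (cylinder n)) Z H"
    "\<And>x. x \<in> topspace (nsphere n) \<Longrightarrow> H (x, 0) = f x"
    "\<And>x. x \<in> topspace (nsphere n) \<Longrightarrow> H (x, 1) = g x"
    "\<And>t. t \<in> {0..1} \<Longrightarrow> H (sphere_base, t) = z"
    using assms by (rule based_homotopyE) (rule that)
  have "continuous_map (cylinder n) (cylinder n) (\<lambda>(x, t). (x, 1 - t))"
    by (auto simp: continuous_map_pairwise o_def case_prod_unfold continuous_map_in_subtopology
        intro!: continuous_intros continuous_map_fst continuous_map_snd
          continuous_map_into_fulltopology[OF continuous_map_snd])
  from pcontinuous_compose_map[OF this H(1)] show ?thesis
    by (rule based_homotopyI) (use H in auto)
qed

lemma based_homotopy_trans: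
  assumes "(f, g) \<in> based_homotopy_rel n Z z" "(g, h) \<in> based_homotopy_rel n Z z"
  shows "(f, h) \<in> based_homotopy_rel n Z z"
proof -
  obtain H where H: "pcontinuous (pretop_of (cylinder n)) Z H"
    "\<And>x. x \<in> topspace (nsphere n) \<Longrightarrow> H (x, 0) = f x"
    "\<And>x. x \<in> topspace (nsphere n) \<Longrightarrow> H (x, 1) = g x"
    "\<And>t. t \<in> {0..1} \<Longrightarrow> H (sphere_base, t) = z"
    using assms(1) by (rule based_homotopyE) (rule that)
  obtain K where K: "pcontinuous (pretop_of (cylinder n)) Z K"
    "\<And>x. x \<in> topspace (nsphere n) \<Longrightarrow> K (x, 0) = g x"
    "\<And>x. x \<in> topspace (nsphere n) \<Longrightarrow> K (x, 1) = h x"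
    "\<And>t. t \<in> {0..1} \<Longrightarrow> K (sphere_base, t) = z"
    using assms(2) by (rule based_homotopyE) (rule that)
  define A where "A = topspace (nsphere n) \<times> {0..1/2::real}"
  define B where "B = topspace (nsphere n) \<times> {1/2..1::real}"
  have cl: "closedin (cylinder n) A" "closedin (cylinder n) B"
    by (auto simp: A_def B_def closedin_prod_Times_iff closedin_subtopology_Int_closed
        intro!: closedin_subset_topspace)
  have *: "continuous_map (subtopology (cylinder n) A) (cylinder n) (\<lambda>(x, t). (x, 2 * t))"
      "continuous_map (subtopology (cylinder n) B) (cylinder n) (\<lambda>(x, t). (x, 2 * t - 1))"
    by (auto simp: A_def B_def continuous_map_pairwise o_def case_prod_unfold
        continuous_map_in_subtopology
        intro!: continuous_intros continuous_map_from_subtopology continuous_map_fst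
          continuous_map_into_fulltopology[OF continuous_map_snd])
  have "pcontinuous (pretop_of (cylinder n)) Z (\<lambda>x. if x \<in> A then (H \<circ> (\<lambda>(x, t). (x, 2 * t))) x
      else (K \<circ> (\<lambda>(x, t). (x, 2 * t - 1))) x)"
  proof (rule pcontinuous_pasting[OF cl])
    show "topspace (cylinder n) \<subseteq> A \<union> B"
      by (auto simp: A_def B_def)
    show "(H \<circ> (\<lambda>(x, t). (x, 2 * t))) x = (K \<circ> (\<lambda>(x, t). (x, 2 * t - 1))) x"
      if "x \<in> A" "x \<in> B" for x
    proof -
      obtain y where "x = (y, 1 / 2)" "y \<in> topspace (nsphere n)"
        using \<open>x \<in> A\<close> \<open>x \<in> B\<close> by (cases x) (auto simp: A_def B_def)
      then show ?thesis
        using H(3) K(2) by simp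
    qed
  qed (intro pcontinuous_compose_map[OF *(1) H(1)] pcontinuous_compose_map[OF *(2) K(1)])+
  then show ?thesis
    by (rule based_homotopyI) (use H K sphere_base_in_nsphere[of n] in \<open>auto simp: A_def\<close>)
qed

lemma based_homotopy_refl:
  assumes "f \<in> based_maps n Z z"
  shows "(f, f) \<in> based_homotopy_rel n Z z"
proof -
  have "pcontinuous (pretop_of (cylinder n)) Z (f \<circ> fst)"
    using assms by (intro pcontinuous_compose_map[of _ "nsphere n"]) (auto simp: continuous_map_fst based_maps_def)
  then show ?thesis
    by (rule based_homotopyI) (use assms in \<open>auto simp: based_maps_def\<close>)
qed

lemma equiv_based_homotopy: "equiv (based_maps n Z z) (based_homotopy_rel n Z z)"
  by (rule equivI)
    (auto simp: refl_on_def sym_def trans_def based_homotopy_refl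
      intro: based_homotopy_sym based_homotopy_trans, auto simp: based_homotopy_rel_def)

section \<open>The pinch map\<close>

lemma nsphere_top_of_set:
  "nsphere n = top_of_set {x. (\<Sum>i\<le>n. (x i)\<^sup>2) = 1 \<and> (\<forall>i>n. x i = 0)}"
  by (simp add: nsphere euclidean_product_topology conj_commute)

lemma topspace_nsphere_iff:
  "x \<in> topspace (nsphere n) \<longleftrightarrow> (\<Sum>i\<le>n. (x i)\<^sup>2) = 1 \<and> (\<forall>i>n. x i = 0)"
  by (simp add: nsphere_top_of_set)

lemma nsphere_square_le:
  assumes "x \<in> topspace (nsphere n)" "i \<noteq> j"
  shows "(x i)\<^sup>2 + (x j)\<^sup>2 \<le> 1"
proof -
  have "(\<Sum>k\<in>{i, j}. (x k)\<^sup>2) = (\<Sum>k\<in>{i, j} \<inter> {..n}. (x k)\<^sup>2)"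
    using assms(1) by (intro sum.mono_neutral_right) (auto simp: topspace_nsphere_iff not_le[symmetric])
  also have "\<dots> \<le> (\<Sum>k\<le>n. (x k)\<^sup>2)"
    by (intro sum_mono2) auto
  finally show ?thesis
    using assms by (auto simp: topspace_nsphere_iff)
qed

lemma nsphere_coordinate_le_1:
  assumes "x \<in> topspace (nsphere n)"
  shows "\<bar>x i\<bar> \<le> 1"
proof -
  have "(x i)\<^sup>2 \<le> 1"
    using nsphere_square_le[OF assms, of i "Suc i"] zero_le_power2[of "x (Suc i)"] by linarith
  then show ?thesis
    by (simp add: abs_square_le_1)
qed

lemma nsphere_eq_base:
  assumes "x \<in> topspace (nsphere n)" "x 0 = 1"
  shows "x = sphere_base"
proof
  fix i show "x i = sphere_base i"
    using nsphere_square_le[OF assms(1), of 0 i] assms(2) by (auto simp: sphere_base_def)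
qed

text \<open>The factor may jump at the base point but stays bounded, because
  \<open>(x n)\<^sup>2\<close> is at most \<open>(1 + x 0) * (1 - x 0)\<close> on the sphere. At the
  base point itself, division by zero gives 0.\<close>

lemma pinch_factor_bound:
  assumes "n \<ge> 1" "x \<in> topspace (nsphere n)"
  shows "\<bar>(x n)\<^sup>2 / (1 - x 0)\<bar> \<le> 2"
proof (cases "x 0 = 1")
  case False
  have "x 0 < 1"
    using nsphere_coordinate_le_1[OF assms(2), of 0] False by auto
  have "(x n)\<^sup>2 \<le> 1 - (x 0)\<^sup>2"
    using nsphere_square_le[OF assms(2), of 0 n] assms(1) by auto
  also have "\<dots> = (1 + x 0) * (1 - x 0)"
    by (simp add: algebra_simps power2_eq_square)
  also have "\<dots> \<le> 2 * (1 - x 0)"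
    using \<open>x 0 < 1\<close> by (intro mult_right_mono) auto
  finally show ?thesis
    using \<open>x 0 < 1\<close> by (simp add: abs_if field_simps)
qed simp

text \<open>The squared norm of the image differs from 1 by a multiple of
  \<open>c * (1 - x 0) - (x n)\<^sup>2\<close>, which vanishes by the choice of
  \<open>c\<close>.\<close>

lemma pinch_in_nsphere:
  assumes n: "n \<ge> 1" and x: "x \<in> topspace (nsphere n)"
  shows "pinch n x \<in> topspace (nsphere n)"
proof -
  let ?b = sphere_base
  define c where "c = (x n)\<^sup>2 / (1 - x 0)"
  \<comment> \<open>At the base point division by zero makes \<open>c\<close> vanish, and the
    equation survives because \<open>x n\<close> is 0 there as well.\<close>
  have c: "c * (1 - x 0) = (x n)\<^sup>2"
  proof (cases "x 0 = 1")
    case True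
    then have "x n = 0"
      using nsphere_eq_base[OF x] n by (simp add: sphere_base_def)
    then show ?thesis by (simp add: True)
  qed (simp add: c_def)
  define z where "z i = (1 - 2 * c) * ?b i + 2 * c * x i" for i
  have p: "pinch n x i = z i - (if i = n then 2 * x n else 0)" for i
    unfolding pinch_def z_def c_def[symmetric] by (simp add: algebra_simps)
  have base: "(\<Sum>i\<le>n. (?b i)\<^sup>2) = 1" "(\<Sum>i\<le>n. ?b i * x i) = x 0"
    using sphere_base_in_nsphere[of n]
    by (auto simp: topspace_nsphere_iff sphere_base_def if_distrib[of "\<lambda>y. y * _"] cong: if_cong)
  have "(\<Sum>i\<le>n. (z i)\<^sup>2) = (\<Sum>i\<le>n. (1 - 2 * c)\<^sup>2 * (?b i)\<^sup>2 + 4 * c\<^sup>2 * (x i)\<^sup>2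
      + 4 * c * (1 - 2 * c) * (?b i * x i))"
    by (rule sum.cong) (auto simp: z_def power2_eq_square algebra_simps)
  also have "\<dots> = (1 - 2 * c)\<^sup>2 + 4 * c\<^sup>2 + 4 * c * (1 - 2 * c) * x 0"
    using x base by (simp add: sum.distrib sum_distrib_left[symmetric] topspace_nsphere_iff)
  finally have z: "(\<Sum>i\<le>n. (z i)\<^sup>2) = (1 - 2 * c)\<^sup>2 + 4 * c\<^sup>2 + 4 * c * (1 - 2 * c) * x 0" .
  have "(\<Sum>i\<le>n. (pinch n x i)\<^sup>2)
      = (\<Sum>i\<le>n. (z i)\<^sup>2 + (if i = n then 4 * (x n)\<^sup>2 - 4 * x n * z n else 0))"
    by (rule sum.cong) (auto simp: p power2_eq_square algebra_simps)
  also have "\<dots> = (\<Sum>i\<le>n. (z i)\<^sup>2) + 4 * (x n)\<^sup>2 - 4 * x n * z n"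
    by (simp add: sum.distrib)
  also have "\<dots> = 1 + (8 * c - 4) * (c * (1 - x 0) - (x n)\<^sup>2)"
    unfolding z using n by (simp add: z_def sphere_base_def power2_eq_square algebra_simps)
  finally have "(\<Sum>i\<le>n. (pinch n x i)\<^sup>2) = 1"
    by (simp add: c)
  moreover have "pinch n x i = 0" if "i > n" for i
    using x that n by (simp add: pinch_def sphere_base_def topspace_nsphere_iff)
  ultimately show ?thesis
    by (simp add: topspace_nsphere_iff)
qed

text \<open>Only the base point is critical. There a bounded factor is multiplied by a difference
  that tends to 0.\<close>

lemma continuous_map_pinch:
  assumes n: "n \<ge> 1"
  shows "continuous_map (nsphere n) (nsphere n) (pinch n)"
proof -
  let ?S = "topspace (nsphere n)"
  have coord: "continuous_on ?S (\<lambda>x :: nat \<Rightarrow> real. x i)" for i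
    by (rule continuous_on_subset[OF continuous_on_product_coordinates subset_UNIV])
  have *: "continuous_on ?S (\<lambda>x. (x n)\<^sup>2 / (1 - x 0) * (x i - sphere_base i))" for i
    unfolding continuous_on_eq_continuous_within
  proof
    fix x assume x: "x \<in> ?S"
    have cw: "continuous (at x within ?S) (\<lambda>x. x j)" for j
      using coord x by (simp add: continuous_on_eq_continuous_within)
    show "continuous (at x within ?S) (\<lambda>x. (x n)\<^sup>2 / (1 - x 0) * (x i - sphere_base i))"
    proof (cases "x 0 = 1")
      case False
      then show ?thesis
        by (intro continuous_intros cw) auto
    next
      case True
      then have xb: "x = sphere_base"
        using nsphere_eq_base x by blast
      have "((\<lambda>y. 2 * \<bar>y i - sphere_base i\<bar>) \<longlongrightarrow> 2 * \<bar>x i - sphere_base i\<bar>) (at x within ?S)"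
        using cw[of i] by (intro tendsto_intros) (simp add: continuous_within)
      then have "((\<lambda>y. 2 * \<bar>y i - sphere_base i\<bar>) \<longlongrightarrow> 0) (at x within ?S)"
        by (simp add: xb)
      moreover have "eventually (\<lambda>y. norm ((y n)\<^sup>2 / (1 - y 0) * (y i - sphere_base i))
          \<le> 2 * \<bar>y i - sphere_base i\<bar>) (at x within ?S)"
        unfolding eventually_at_filter real_norm_def abs_mult
        by (intro always_eventually allI impI mult_right_mono pinch_factor_bound[OF n]) auto
      ultimately show ?thesis
        unfolding continuous_within by (simp add: xb Lim_null_comparison)
    qed
  qed
  have "continuous_on ?S (\<lambda>x. pinch n x i)" for i
    unfolding pinch_def
    using continuous_on_add[OF continuous_on_const continuous_on_mult[OF continuous_on_const *], of "sphere_base i" 2 i]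
    by (cases "i = n") (auto simp: mult.assoc intro!: continuous_on_diff continuous_on_mult coord)
  then have "continuous_on ?S (pinch n)"
    by (rule continuous_on_coordinatewise_then_product)
  then have "continuous_map (top_of_set ?S) (top_of_set ?S) (pinch n)"
    using pinch_in_nsphere[OF n] by auto
  moreover have "nsphere n = top_of_set ?S"
    by (simp add: nsphere_top_of_set)
  ultimately show ?thesis
    by metis
qed

lemma pinch_equator:
  assumes "n \<ge> 1" "x n = 0"
  shows "pinch n x = sphere_base"
  using assms by (simp add: pinch_def fun_eq_iff)

text \<open>At each time both homotopies are composed with the pinch map. They agree over the
  equator, which is pinched to the base point, where both rest at \<open>z\<close>. Applied to
  constant homotopies, this also shows that concatenations of based maps are based maps.\<close>

lemma based_homotopy_concat:
  assumes n: "n \<ge> 1" and f: "(f, f') \<in> based_homotopy_rel n Z z"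
    and g: "(g, g') \<in> based_homotopy_rel n Z z"
  shows "(sphere_concat n f g, sphere_concat n f' g') \<in> based_homotopy_rel n Z z"
proof -
  obtain F where F: "pcontinuous (pretop_of (cylinder n)) Z F"
    "\<And>x. x \<in> topspace (nsphere n) \<Longrightarrow> F (x, 0) = f x"
    "\<And>x. x \<in> topspace (nsphere n) \<Longrightarrow> F (x, 1) = f' x"
    "\<And>t. t \<in> {0..1} \<Longrightarrow> F (sphere_base, t) = z"
    using f by (rule based_homotopyE) (rule that)
  obtain G where G: "pcontinuous (pretop_of (cylinder n)) Z G"
    "\<And>x. x \<in> topspace (nsphere n) \<Longrightarrow> G (x, 0) = g x"
    "\<And>x. x \<in> topspace (nsphere n) \<Longrightarrow> G (x, 1) = g' x"
    "\<And>t. t \<in> {0..1} \<Longrightarrow> G (sphere_base, t) = z"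
    using g by (rule based_homotopyE) (rule that)
  define k where "k = (\<lambda>p :: (nat \<Rightarrow> real) \<times> real. (pinch n (fst p), snd p))"
  have k: "continuous_map (cylinder n) (cylinder n) k"
    unfolding k_def
    by (auto simp: continuous_map_pairwise o_def continuous_map_snd
        intro: continuous_map_compose[OF continuous_map_fst continuous_map_pinch[OF n], unfolded o_def])
  define A where "A = {p \<in> topspace (cylinder n). fst p n \<in> {0..}}"
  define B where "B = {p \<in> topspace (cylinder n). fst p n \<in> {..0}}"
  have last: "continuous_map (cylinder n) euclideanreal (\<lambda>p. fst p n)"
    using continuous_map_compose[OF continuous_map_fst continuous_map_nsphere_projection] by (simp add: o_def)
  have "pcontinuous (pretop_of (cylinder n)) Z (\<lambda>p. if p \<in> A then (F \<circ> k) p else (G \<circ> k) p)"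
  proof (rule pcontinuous_pasting)
    show "closedin (cylinder n) A" "closedin (cylinder n) B"
      unfolding A_def B_def by (intro closedin_continuous_map_preimage[OF last], simp)+
    show "topspace (cylinder n) \<subseteq> A \<union> B"
      by (auto simp: A_def B_def)
    show "(F \<circ> k) p = (G \<circ> k) p" if "p \<in> A" "p \<in> B" for p
    proof -
      have "k p = (sphere_base, snd p)" "snd p \<in> {0..1}"
        using that pinch_equator[OF n, of "fst p"] by (auto simp: k_def A_def B_def)
      then show ?thesis
        using F(4) G(4) by simp
    qed
  qed (intro pcontinuous_subtopology pcontinuous_compose_map[OF k] F(1) G(1))+
  then show ?thesis
  proof (rule based_homotopyI)
    have "k (sphere_base, t) = (sphere_base, t)" for t
      using pinch_equator[OF n, of sphere_base] n by (simp add: k_def sphere_base_def)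
    then show "(if (sphere_base, t) \<in> A then (F \<circ> k) (sphere_base, t) else (G \<circ> k) (sphere_base, t)) = z"
      if "t \<in> {0..1}" for t
      using F(4) G(4) that by simp
  qed (use pinch_in_nsphere[OF n] F G in \<open>auto simp: k_def A_def sphere_concat_def\<close>)
qed

section \<open>Realizations of the clique complex\<close>

text \<open>For a point of a realization this is the vertex set of its carrier, the smallest simplex
  that contains it.\<close>

definition supp :: "('a \<Rightarrow> real) \<Rightarrow> 'a set" where
  "supp t = {v. t v \<noteq> 0}"

lemma supp_indicator [simp]: "supp (indicator {v}) = {v}"
  by (auto simp: supp_def indicator_def)

lemma clique_complex_subset:
  "\<sigma> \<in> clique_complex X E \<Longrightarrow> \<tau> \<subseteq> \<sigma> \<Longrightarrow> \<tau> \<noteq> {} \<Longrightarrow> \<tau> \<in> clique_complex X E"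
  unfolding clique_complex_def by (auto intro: finite_subset)

lemma finite_clique: "\<sigma> \<in> clique_complex X E \<Longrightarrow> finite \<sigma>"
  by (simp add: clique_complex_def)

lemma geom_simplex_iff:
  assumes "finite \<sigma>"
  shows "t \<in> geom_simplex \<sigma> \<longleftrightarrow> (\<forall>v. 0 \<le> t v) \<and> supp t \<subseteq> \<sigma> \<and> sum t (supp t) = 1"
proof -
  have "sum t (supp t) = sum t \<sigma>" if "supp t \<subseteq> \<sigma>"
    using that assms by (intro sum.mono_neutral_left) (auto simp: supp_def)
  moreover have "(\<forall>v. v \<notin> \<sigma> \<longrightarrow> t v = 0) \<longleftrightarrow> supp t \<subseteq> \<sigma>"
    by (auto simp: supp_def)
  ultimately show ?thesis
    unfolding geom_simplex_def mem_Collect_eq by metis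
qed

text \<open>A single function is cut out by equations on its coordinates. The lemma serves to show
  that a set meeting every simplex in finitely many points is closed in the weak topology.\<close>

lemma closed_finite_functions:
  fixes S :: "('a \<Rightarrow> real) set"
  assumes "finite S"
  shows "closed S"
proof -
  have "closed {t. \<forall>v. t v = f v}" for f :: "'a \<Rightarrow> real"
    by (intro closed_Collect_all closed_Collect_eq continuous_on_const continuous_on_product_coordinates)
  then have "closed {f}" for f :: "'a \<Rightarrow> real"
    by (simp flip: fun_eq_iff)
  then have "closed (\<Union>f\<in>S. {f})"
    using assms by (intro closed_UN) auto
  then show ?thesis
    by simp
qed

lemma closed_geom_simplex: "closed (geom_simplex \<sigma>)"
  unfolding geom_simplex_def
proof (intro closed_Collect_conj closed_Collect_all)
  fix v
  show "closed {t :: 'a \<Rightarrow> real. 0 \<le> t v}"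
    by (intro closed_Collect_le continuous_on_const continuous_on_product_coordinates)
  show "closed {t :: 'a \<Rightarrow> real. v \<notin> \<sigma> \<longrightarrow> t v = 0}"
    by (cases "v \<in> \<sigma>")
      (auto intro!: closed_Collect_eq continuous_on_const continuous_on_product_coordinates)
  show "closed {t :: 'a \<Rightarrow> real. sum t \<sigma> = 1}"
    by (intro closed_Collect_eq continuous_on_const continuous_on_sum continuous_on_product_coordinates)
qed

text \<open>Simplices are closed in the product topology, so relatively closed subsets of a simplex
  are closed outright.\<close>

lemma closedin_geom_realization:
  "closedin (geom_realization K) C \<longleftrightarrow>
     C \<subseteq> geom_points K \<and> (\<forall>\<sigma>\<in>K. closed (C \<inter> geom_simplex \<sigma>))"
proof -
  have "openin (top_of_set (geom_simplex \<sigma>)) ((geom_points K - C) \<inter> geom_simplex \<sigma>) \<longleftrightarrow>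
      closed (C \<inter> geom_simplex \<sigma>)" if "\<sigma> \<in> K" for \<sigma>
  proof -
    have "(geom_points K - C) \<inter> geom_simplex \<sigma> = geom_simplex \<sigma> - (C \<inter> geom_simplex \<sigma>)"
      using that by (auto simp: geom_points_def)
    then show ?thesis
      using closedin_closed_eq[OF closed_geom_simplex, of \<sigma> "C \<inter> geom_simplex \<sigma>"]
      by (simp add: closedin_def)
  qed
  then show ?thesis
    by (simp add: closedin_def topspace_geom_realization openin_geom_realization)
qed

lemma continuous_map_geom_realization_coordinate:
  "continuous_map (geom_realization K) euclideanreal (\<lambda>t. t v)"
  unfolding continuous_map_closedin
proof (intro conjI allI impI)
  fix C :: "real set" assume "closedin euclidean C"
  then have "closed ((\<lambda>t :: 'a \<Rightarrow> real. t v) -` C)"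
    using closed_vimage[OF _ continuous_on_product_coordinates] by auto
  then have "closed ({t \<in> geom_points K. t v \<in> C} \<inter> geom_simplex \<sigma>)" if "\<sigma> \<in> K" for \<sigma>
  proof -
    have "{t \<in> geom_points K. t v \<in> C} \<inter> geom_simplex \<sigma> = (\<lambda>t. t v) -` C \<inter> geom_simplex \<sigma>"
      using that by (auto simp: geom_points_def)
    then show ?thesis
      using \<open>closed ((\<lambda>t. t v) -` C)\<close> closed_geom_simplex by auto
  qed
  then show "closedin (geom_realization K) {t \<in> topspace (geom_realization K). t v \<in> C}"
    by (auto simp: closedin_geom_realization topspace_geom_realization)
qed simp

text \<open>The carrier of a point is a nonempty face of any simplex containing the point, hence
  itself a clique.\<close>

lemma geom_points_clique_iff:
  "t \<in> geom_points (clique_complex X E) \<longleftrightarrow>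
     (\<forall>v. 0 \<le> t v) \<and> supp t \<in> clique_complex X E \<and> sum t (supp t) = 1"
proof
  assume "t \<in> geom_points (clique_complex X E)"
  then obtain \<sigma> where \<sigma>: "\<sigma> \<in> clique_complex X E" "t \<in> geom_simplex \<sigma>"
    by (auto simp: geom_points_def)
  then have *: "(\<forall>v. 0 \<le> t v) \<and> supp t \<subseteq> \<sigma> \<and> sum t (supp t) = 1"
    by (subst (asm) geom_simplex_iff) (auto simp: clique_complex_def)
  moreover from this have "supp t \<noteq> {}"
    by force
  ultimately show "(\<forall>v. 0 \<le> t v) \<and> supp t \<in> clique_complex X E \<and> sum t (supp t) = 1"
    using clique_complex_subset[OF \<sigma>(1)] by blast
next
  assume *: "(\<forall>v. 0 \<le> t v) \<and> supp t \<in> clique_complex X E \<and> sum t (supp t) = 1"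
  then have "t \<in> geom_simplex (supp t)"
    by (subst geom_simplex_iff) (auto simp: clique_complex_def)
  with * show "t \<in> geom_points (clique_complex X E)"
    by (auto simp: geom_points_def)
qed

lemma supp_nonempty: "t \<in> geom_points (clique_complex X E) \<Longrightarrow> supp t \<noteq> {}"
  by (force simp: geom_points_clique_iff)

lemma eq_indicator_if_supp:
  assumes "t \<in> geom_points (clique_complex X E)" "supp t \<subseteq> {v}"
  shows "t = indicator {v}"
proof -
  have "sum t (supp t) = 1"
    using assms(1) by (simp add: geom_points_clique_iff)
  then have "supp t = {v}"
    using assms(2) by (auto simp: subset_singleton_iff)
  with \<open>sum t (supp t) = 1\<close> show ?thesis
    by (auto simp: supp_def indicator_def fun_eq_iff)
qed

lemma geom_points_indicator:
  "{v} \<in> clique_complex X E \<Longrightarrow> indicator {v} \<in> geom_points (clique_complex X E)"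
  unfolding geom_points_clique_iff supp_indicator by simp

text \<open>Both points lie in the simplex spanned by the union of their carriers, and simplices are
  convex.\<close>

lemma geom_points_convex_combination:
  assumes p: "p \<in> geom_points (clique_complex X E)" and q: "q \<in> geom_points (clique_complex X E)"
    and pq: "supp p \<union> supp q \<in> clique_complex X E" and \<alpha>: "0 \<le> \<alpha>" "\<alpha> \<le> 1"
  shows "(\<lambda>v. (1 - \<alpha>) * p v + \<alpha> * q v) \<in> geom_points (clique_complex X E)"
    and "supp (\<lambda>v. (1 - \<alpha>) * p v + \<alpha> * q v) \<subseteq> supp p \<union> supp q"
proof -
  let ?\<sigma> = "supp p \<union> supp q" and ?m = "\<lambda>v. (1 - \<alpha>) * p v + \<alpha> * q v"
  show "supp ?m \<subseteq> ?\<sigma>"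
    by (auto simp: supp_def)
  have "finite ?\<sigma>"
    using pq by (auto simp: clique_complex_def)
  moreover have "p \<in> geom_simplex ?\<sigma>" "q \<in> geom_simplex ?\<sigma>"
    using p q \<open>finite ?\<sigma>\<close> by (auto simp: geom_simplex_iff geom_points_clique_iff)
  ultimately have "?m \<in> geom_simplex ?\<sigma>"
    using \<alpha> unfolding geom_simplex_def
    by (auto simp: sum.distrib sum_distrib_left[symmetric])
  then show "?m \<in> geom_points (clique_complex X E)"
    using pq by (auto simp: geom_points_def)
qed

text \<open>Only the finitely many simplices with vertices in \<open>F\<close> are met, and on their
  union the weak topology agrees with the product topology. Coordinatewise continuity therefore
  suffices.\<close>

lemma continuous_map_into_geom_realization:
  assumes "finite F"
    and G: "\<And>x. x \<in> topspace T \<Longrightarrow> G x \<in> geom_points (clique_complex X E)"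
    and F: "\<And>x. x \<in> topspace T \<Longrightarrow> supp (G x) \<subseteq> F"
    and cont: "\<And>v. v \<in> F \<Longrightarrow> continuous_map T euclideanreal (\<lambda>x. G x v)"
  shows "continuous_map T (geom_realization (clique_complex X E)) G"
  unfolding continuous_map_closedin
proof (intro conjI allI impI)
  let ?K = "clique_complex X E"
  show "G \<in> topspace T \<rightarrow> topspace (geom_realization ?K)"
    using G by (simp add: topspace_geom_realization)
  fix C assume C: "closedin (geom_realization ?K) C"
  have "continuous_map T euclideanreal (\<lambda>x. G x v)" for v
  proof (cases "v \<in> F")
    case False
    then have "\<And>x. x \<in> topspace T \<Longrightarrow> G x v = 0"
      using F by (auto simp: supp_def)
    then show ?thesis
      by (simp add: continuous_map_eq[OF continuous_map_const[THEN iffD2]])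
  qed (rule cont)
  then have "continuous_map T euclidean G"
    by (simp flip: euclidean_product_topology add: continuous_map_componentwise_UNIV)
  \<comment> \<open>\<open>C\<close> may fail to be closed in the product topology, but its part
    \<open>D\<close> in the simplices over \<open>F\<close> is a finite union of closed sets. The
    values of \<open>G\<close> cannot tell \<open>C\<close> from \<open>D\<close>.\<close>
  moreover define D where "D = (\<Union>\<sigma>\<in>{\<sigma> \<in> ?K. \<sigma> \<subseteq> F}. C \<inter> geom_simplex \<sigma>)"
  have "finite {\<sigma> \<in> ?K. \<sigma> \<subseteq> F}"
    using \<open>finite F\<close> by (auto intro: finite_subset[of _ "Pow F"])
  then have "closed D"
    unfolding D_def using C by (intro closed_UN) (auto simp: closedin_geom_realization)
  ultimately have "closedin T {x \<in> topspace T. G x \<in> D}"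
    by (intro closedin_continuous_map_preimage[of T euclidean]) auto
  moreover have "G x \<in> D \<longleftrightarrow> G x \<in> C" if x: "x \<in> topspace T" for x
  proof -
    have "supp (G x) \<in> ?K" "supp (G x) \<subseteq> F" "G x \<in> geom_simplex (supp (G x))"
      using G[OF x] F[OF x] by (auto simp: geom_points_clique_iff geom_simplex_iff dest: finite_clique)
    then show ?thesis
      by (auto simp: D_def)
  qed
  ultimately show "closedin T {x \<in> topspace T. G x \<in> C}"
    by (simp cong: conj_cong)
qed

text \<open>One point is chosen for each carrier that occurs. Every subset of the chosen set meets
  each simplex in finitely many points and so is closed; thus the chosen set is closed and discrete
  inside a compact set, hence finite.\<close>

lemma finite_supp_compact:
  assumes "compactin (geom_realization (clique_complex X E)) Q"
  shows "finite (\<Union>t\<in>Q. supp t)"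
proof -
  let ?K = "clique_complex X E"
  let ?R = "geom_realization ?K"
  have Q: "Q \<subseteq> geom_points ?K"
    using compactin_subset_topspace[OF assms] by (simp add: topspace_geom_realization)
  obtain D where D: "D \<subseteq> Q" "inj_on supp D" "supp ` D = supp ` Q"
    by (metis subset_image_inj subset_refl)
  have cl: "closedin ?R C" if "C \<subseteq> D" for C
    unfolding closedin_geom_realization
  proof (intro conjI ballI)
    show "C \<subseteq> geom_points ?K"
      using that D(1) Q by blast
    fix \<sigma> assume "\<sigma> \<in> ?K"
    then have "finite \<sigma>"
      by (simp add: clique_complex_def)
    have "inj_on supp (C \<inter> geom_simplex \<sigma>)"
      using inj_on_subset[OF D(2)] that by blast
    moreover have "supp ` (C \<inter> geom_simplex \<sigma>) \<subseteq> Pow \<sigma>"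
      using \<open>finite \<sigma>\<close> by (auto simp: geom_simplex_iff)
    ultimately have "finite (C \<inter> geom_simplex \<sigma>)"
      using \<open>finite \<sigma>\<close> by (meson finite_Pow_iff inj_on_finite)
    then show "closed (C \<inter> geom_simplex \<sigma>)"
      by (rule closed_finite_functions)
  qed
  have "finite D"
  proof (rule ccontr)
    assume "infinite D"
    \<comment> \<open>An infinite \<open>D\<close> would have a limit point \<open>x\<close>, but
      the complement of the closed set \<open>D - {x}\<close> is a neighborhood of \<open>x\<close>
      that contains no other point of \<open>D\<close>.\<close>
    then have "Q \<inter> ?R derived_set_of D \<noteq> {}"
      using D(1) by (intro compactin_imp_Bolzano_Weierstrass[OF assms]) simp
    then obtain x where x: "x \<in> ?R derived_set_of D"
      by blast
    have "x \<in> topspace ?R"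
      using x by (simp add: in_derived_set_of)
    then have "openin ?R (topspace ?R - (D - {x})) \<and> x \<in> topspace ?R - (D - {x})"
      using cl[of "D - {x}"] by blast
    moreover have "\<And>U. x \<in> U \<and> openin ?R U \<Longrightarrow> \<exists>y. y \<noteq> x \<and> y \<in> D \<and> y \<in> U"
      using x by (simp add: in_derived_set_of)
    ultimately show False
      by (metis DiffD2 DiffI singletonD)
  qed
  then have "finite (supp ` Q)"
    using D(3) by (metis finite_imageI)
  moreover have "finite (supp t)" if "t \<in> Q" for t
    using Q that finite_clique[of "supp t" X E] by (auto simp: geom_points_clique_iff)
  ultimately show ?thesis
    by blast
qed

section \<open>Closed stars and neighborhoods in the intermediate realization\<close>

definition star :: "'a set \<Rightarrow> ('a \<times> 'a) set \<Rightarrow> 'a \<Rightarrow> ('a \<Rightarrow> real) set" where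
  "star X E v = {t \<in> geom_points (clique_complex X E). insert v (supp t) \<in> clique_complex X E}"

text \<open>Identifies the closed star, written through carriers so that membership is a clique
  condition, with the generator of the neighborhood filter at a vertex.\<close>

lemma star_eq_Union:
  "star X E v = \<Union>{geom_simplex \<sigma> | \<sigma>. \<sigma> \<in> clique_complex X E \<and> v \<in> \<sigma>}"
proof (rule equalityI; rule subsetI)
  fix t assume "t \<in> star X E v"
  then have *: "insert v (supp t) \<in> clique_complex X E" "t \<in> geom_points (clique_complex X E)"
    by (auto simp: star_def)
  then have "t \<in> geom_simplex (insert v (supp t))"
    using finite_clique by (subst geom_simplex_iff) (auto simp: geom_points_clique_iff)
  with * show "t \<in> \<Union>{geom_simplex \<sigma> | \<sigma>. \<sigma> \<in> clique_complex X E \<and> v \<in> \<sigma>}"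
    by blast
next
  fix t assume "t \<in> \<Union>{geom_simplex \<sigma> | \<sigma>. \<sigma> \<in> clique_complex X E \<and> v \<in> \<sigma>}"
  then obtain \<sigma> where \<sigma>: "\<sigma> \<in> clique_complex X E" "v \<in> \<sigma>" "t \<in> geom_simplex \<sigma>"
    by blast
  then have "insert v (supp t) \<subseteq> \<sigma>"
    using geom_simplex_iff[of \<sigma> t] by (auto simp: clique_complex_def)
  then show "t \<in> star X E v"
    using \<sigma> clique_complex_subset[OF \<sigma>(1)] by (auto simp: star_def geom_points_def)
qed

text \<open>This is what makes jumps continuous: a vertex has a smallest neighborhood, and it is the
  whole closed star.\<close>

lemma eventually_nhood_vertex:
  "v \<in> X \<Longrightarrow> eventually P (nhood (intermediate_realization X E) (indicator {v})) \<longleftrightarrow>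
     (\<forall>t\<in>star X E v. P t)"
  by (simp add: nhood_intermediate_realization_vertex star_eq_Union eventually_principal)

lemma nhood_nonvertex:
  "\<nexists>v. v \<in> X \<and> z = indicator {v} \<Longrightarrow>
     nhood (intermediate_realization X E) z = nhdsin (geom_realization (clique_complex X E)) z"
  by (auto simp: intermediate_realization_def)

lemma points_intermediate_realization [simp]:
  "points (intermediate_realization X E) = geom_points (clique_complex X E)"
  by (simp add: intermediate_realization_def)

text \<open>At a vertex the closed star is a neighborhood by definition. At any other point the open
  star, where the coordinate at \<open>v\<close> is positive, is weakly open and contained in the
  closed star.\<close>

lemma eventually_star:
  assumes z: "z \<in> geom_points (clique_complex X E)" and v: "v \<in> supp z"
  shows "eventually (\<lambda>t. t \<in> star X E v) (nhood (intermediate_realization X E) z)"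
proof (cases "\<exists>u. u \<in> X \<and> z = indicator {u}")
  case True
  then show ?thesis
    using v by (auto simp: eventually_nhood_vertex)
next
  case False
  let ?K = "clique_complex X E"
  define U where "U = {t \<in> topspace (geom_realization ?K). t v \<in> {0<..}}"
  have "openin (geom_realization ?K) U"
    unfolding U_def
    by (rule openin_continuous_map_preimage[OF continuous_map_geom_realization_coordinate]) simp
  moreover have "z \<in> U"
    using z v by (auto simp: U_def topspace_geom_realization geom_points_clique_iff supp_def less_le)
  moreover have "U \<subseteq> star X E v"
    by (auto simp: U_def topspace_geom_realization star_def geom_points_clique_iff supp_def insert_absorb)
  ultimately show ?thesis
    unfolding nhood_nonvertex[OF False] eventually_nhdsin by blast
qed

lemma pcontinuous_into_intermediate:
  "continuous_map T (geom_realization (clique_complex X E)) f \<Longrightarrow>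
     pcontinuous (pretop_of T) (intermediate_realization X E) f"
  using pcontinuous_compose[OF _ pcontinuous_Id_KR, of "pretop_of T" X E f]
  by (simp add: pcontinuous_pretop_of_iff Id_KR_def o_def)

text \<open>The vertices form a weakly closed set, since each simplex contains only finitely many.
  Hence a map that hits a nonvertex stays locally where the two realizations have the same
  neighborhoods.\<close>

lemma eventually_nonvertex:
  assumes "z \<in> geom_points (clique_complex X E)" "\<nexists>v. v \<in> X \<and> z = indicator {v}"
  shows "eventually (\<lambda>t. \<nexists>v. v \<in> X \<and> t = indicator {v}) (nhood (intermediate_realization X E) z)"
proof -
  let ?K = "clique_complex X E"
  define V where "V = {t \<in> geom_points ?K. \<exists>v. v \<in> X \<and> t = indicator {v}}"
  have "closedin (geom_realization ?K) V"
    unfolding closedin_geom_realization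
  proof (intro conjI ballI)
    fix \<sigma> assume "\<sigma> \<in> ?K"
    then have "finite \<sigma>"
      by (simp add: clique_complex_def)
    then have "V \<inter> geom_simplex \<sigma> \<subseteq> (\<lambda>v. indicator {v}) ` \<sigma>"
      by (auto simp: V_def geom_simplex_iff)
    with \<open>finite \<sigma>\<close> show "closed (V \<inter> geom_simplex \<sigma>)"
      by (meson finite_imageI closed_finite_functions finite_subset)
  qed (auto simp: V_def)
  then have "openin (geom_realization ?K) (geom_points ?K - V)"
    by (simp add: closedin_def topspace_geom_realization)
  moreover have "z \<in> geom_points ?K - V"
    using assms by (auto simp: V_def)
  moreover have "\<forall>t\<in>geom_points ?K - V. \<nexists>v. v \<in> X \<and> t = indicator {v}"
    by (auto simp: V_def)
  ultimately show ?thesis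
    unfolding nhood_nonvertex[OF assms(2)] eventually_nhdsin by blast
qed

section \<open>Approximation by a map into the clique complex\<close>

text \<open>The clique complex is a flag complex. The pairs with \<open>u = v\<close> supply
  membership in \<open>X\<close> and the loops.\<close>

lemma clique_if_pairs:
  assumes "finite A" "A \<noteq> {}" "\<And>u v. u \<in> A \<Longrightarrow> v \<in> A \<Longrightarrow> {u, v} \<in> clique_complex X E"
  shows "A \<in> clique_complex X E"
  using assms unfolding clique_complex_def by auto

text \<open>The conclusion about \<open>U\<close> is shaped for the jump: near \<open>x\<close>, the
  values of \<open>f\<close> and \<open>g\<close> and the vertices chosen by \<open>h\<close> all
  lie in the closed star of \<open>h x\<close>. The last two conclusions control the base point
  \<open>b\<close>.\<close>

lemma vertex_approximation:
  fixes S :: "'b::metric_space set" and f :: "'b \<Rightarrow> 'a \<Rightarrow> real"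
  assumes "compact S" "b \<in> S"
    and f: "pcontinuous (pretop_of (top_of_set S)) (intermediate_realization X E) f"
  obtains F g h where "finite F"
    "\<And>v. continuous_on S (\<lambda>x. g x v)"
    "\<And>x. x \<in> S \<Longrightarrow> g x \<in> geom_points (clique_complex X E)"
    "\<And>x. x \<in> S \<Longrightarrow> supp (g x) \<subseteq> F"
    "\<And>x. x \<in> S \<Longrightarrow> \<exists>U. openin (top_of_set S) U \<and> x \<in> U \<and>
       (\<forall>y\<in>U. insert (h x) (insert (h y) (supp (f y) \<union> supp (g y))) \<in> clique_complex X E)"
    "h b \<in> supp (f b)" "supp (g b) = {h b}"
proof -
  let ?K = "clique_complex X E"
  have fS: "f x \<in> geom_points ?K" if "x \<in> S" for x
    using f that by (auto simp: pcontinuous_from_topology)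
  have "\<exists>v r. v \<in> supp (f x) \<and> 0 < r \<and> (x \<noteq> b \<longrightarrow> r \<le> dist x b) \<and>
      (\<forall>y\<in>S. dist x y < 2 * r \<longrightarrow> f y \<in> star X E v)" if x: "x \<in> S" for x
  proof -
    obtain v where v: "v \<in> supp (f x)"
      using supp_nonempty[OF fS[OF x]] by blast
    have "x \<in> topspace (top_of_set S)"
      using x by simp
    then obtain U where U: "openin (top_of_set S) U" "x \<in> U" "\<forall>y\<in>U. f y \<in> star X E v"
      using f eventually_star[OF fS[OF x] v] unfolding pcontinuous_from_topology by blast
    then obtain e where e: "e > 0" "ball x e \<inter> S \<subseteq> U"
      unfolding openin_contains_ball by blast
    \<comment> \<open>Half of \<open>e\<close> lets the doubled ball fit into \<open>U\<close>; the
      distance to \<open>b\<close> keeps \<open>b\<close> out of the open balls around other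
      centres.\<close>
    define r where "r = (if x = b then e / 2 else min (e / 2) (dist x b))"
    have "0 < r" "x \<noteq> b \<longrightarrow> r \<le> dist x b" "2 * r \<le> e"
      using e(1) by (auto simp: r_def)
    moreover from this have "f y \<in> star X E v" if "y \<in> S" "dist x y < 2 * r" for y
      using e(2) U(3) that by (auto simp: subset_iff)
    ultimately show ?thesis
      using v by blast
  qed
  then obtain v r where v: "\<And>x. x \<in> S \<Longrightarrow> v x \<in> supp (f x)" and r: "\<And>x. x \<in> S \<Longrightarrow> 0 < r x"
    and rb: "\<And>x. x \<in> S \<Longrightarrow> x \<noteq> b \<Longrightarrow> r x \<le> dist x b"
    and fv: "\<And>x y. x \<in> S \<Longrightarrow> y \<in> S \<Longrightarrow> dist x y < 2 * r x \<Longrightarrow> f y \<in> star X E (v x)"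
    by metis
  obtain C where C: "C \<subseteq> S" "finite C" "S \<subseteq> (\<Union>a\<in>C. ball a (r a))"
  proof (rule compactE_image[OF \<open>compact S\<close>])
    show "S \<subseteq> (\<Union>a\<in>S. ball a (r a))"
      using r by force
  qed auto
  define N where "N x = {a \<in> C. dist a x < r a}" for x
  have NC: "a \<in> S" if "a \<in> N x" for a x
    using that C by (auto simp: N_def)
  have N: "N x \<noteq> {}" "finite (N x)" if "x \<in> S" for x
    using subsetD[OF C(3) that] C(2) by (auto simp: N_def)
  have adj: "{v a, v a'} \<in> ?K" if x: "x \<in> S" and a: "a \<in> N x" "a' \<in> N x" for x a a'
  proof -
    \<comment> \<open>The centre of the smaller ball lies in the doubled larger ball.\<close>
    have *: "{v a, v a'} \<in> ?K" if "a \<in> N x" "a' \<in> N x" "r a' \<le> r a" for a a'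
    proof -
      have "dist a a' < 2 * r a"
        using dist_triangle[of a a' x] that by (auto simp: N_def dist_commute)
      then have "f a' \<in> star X E (v a)"
        using fv NC that by blast
      then show ?thesis
        using v[OF NC[OF \<open>a' \<in> N x\<close>]] by (auto simp: star_def elim: clique_complex_subset)
    qed
    show ?thesis
      using *[of a a'] *[of a' a] a by (auto simp: insert_commute intro: le_cases[of "r a" "r a'"])
  qed
  \<comment> \<open>Vertices of active balls are adjacent by \<open>adj\<close>, two vertices of the
    carrier span a face of it, and a mixed pair is adjacent because \<open>f x\<close> lies in the
    closed star of each active vertex.\<close>
  have clq: "v ` N x \<union> supp (f x) \<in> ?K" if x: "x \<in> S" for x
  proof (rule clique_if_pairs)
    have sf: "supp (f x) \<in> ?K"
      using fS[OF x] by (simp add: geom_points_clique_iff)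
    then show "finite (v ` N x \<union> supp (f x))"
      using N[OF x] by (auto dest: finite_clique)
    show "v ` N x \<union> supp (f x) \<noteq> {}"
      using N[OF x] by auto
    have mixed: "{v a, u} \<in> ?K" if "a \<in> N x" "u \<in> supp (f x)" for a u
    proof -
      have "dist a x < 2 * r a"
        using that r[OF NC[OF that(1)]] by (auto simp: N_def)
      then have "f x \<in> star X E (v a)"
        using fv NC that(1) x by blast
      then show ?thesis
        using that(2) by (auto simp: star_def elim: clique_complex_subset)
    qed
    fix u u' assume "u \<in> v ` N x \<union> supp (f x)" "u' \<in> v ` N x \<union> supp (f x)"
    then show "{u, u'} \<in> ?K"
      using adj[OF x] mixed clique_complex_subset[OF sf, of "{u, u'}"]
      by (auto simp: insert_commute)
  qed
  \<comment> \<open>The weights are tent functions, positive exactly on the balls. Several centres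
    may share a vertex, so the coordinate of \<open>g x\<close> at \<open>u\<close> collects all of
    their weights.\<close>
  define w where "w a x = max 0 (r a - dist a x)" for a x
  define W where "W x = (\<Sum>a\<in>C. w a x)" for x
  define g where "g x u = (\<Sum>a\<in>C. if v a = u then w a x / W x else 0)" for x u
  define h where "h x = v (SOME a. a \<in> N x)" for x
  have w0: "w a x \<ge> 0" for a x
    by (simp add: w_def)
  have wN: "w a x \<noteq> 0 \<longleftrightarrow> a \<in> N x" if "a \<in> C" for a x
    using that by (auto simp: w_def N_def)
  have W: "W x > 0" if x: "x \<in> S" for x
  proof -
    obtain a where "a \<in> N x"
      using N[OF x] by blast
    then have "a \<in> C" "w a x > 0"
      using wN[of a x] w0[of a x] by (auto simp: N_def)
    then show ?thesis
      unfolding W_def using C(2) w0 by (intro sum_pos2) auto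
  qed
  have suppg: "supp (g x) = v ` N x" if x: "x \<in> S" for x
  proof -
    \<comment> \<open>Nonnegative weights cannot cancel, so every active vertex belongs to the
      carrier of \<open>g x\<close>.\<close>
    have "g x u = 0 \<longleftrightarrow> (\<forall>a\<in>C. v a = u \<longrightarrow> w a x = 0)" for u
      unfolding g_def using C(2) w0 W[OF x] by (subst sum_nonneg_eq_0_iff) auto
    then show ?thesis
      using wN by (auto simp: supp_def N_def image_iff)
  qed
  have gS: "g x \<in> geom_points ?K" if x: "x \<in> S" for x
    unfolding geom_points_clique_iff
  proof (intro conjI allI)
    show "0 \<le> g x u" for u
      unfolding g_def using w0 W[OF x] by (intro sum_nonneg) auto
    show "supp (g x) \<in> ?K"
      unfolding suppg[OF x] by (rule clique_complex_subset[OF clq[OF x]]) (use N[OF x] in auto)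
    have "sum (g x) (supp (g x)) = sum (g x) (v ` C)"
      using C(2) suppg[OF x] by (intro sum.mono_neutral_left) (auto simp: supp_def N_def)
    also have "\<dots> = (\<Sum>a\<in>C. \<Sum>u\<in>v ` C. if v a = u then w a x / W x else 0)"
      unfolding g_def by (rule sum.swap)
    also have "\<dots> = (\<Sum>a\<in>C. w a x / W x)"
      using C(2) by (intro sum.cong) auto
    also have "\<dots> = 1"
      using W[OF x] by (simp add: W_def flip: sum_divide_distrib)
    finally show "sum (g x) (supp (g x)) = 1" .
  qed
  have cw: "continuous_on S (w a)" for a
    unfolding w_def by (intro continuous_intros)
  have cg: "continuous_on S (\<lambda>x. g x u)" for u
  proof -
    have "continuous_on S (\<lambda>x. if v a = u then w a x / W x else 0)" for a
      using cw W unfolding W_def by (cases "v a = u") (fastforce intro!: continuous_intros)+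
    then show ?thesis
      unfolding g_def by (intro continuous_on_sum)
  qed
  have hN: "h x \<in> v ` N x" if "x \<in> S" for x
    using N[OF that] by (auto simp: h_def some_in_eq)
  have near: "\<exists>U. openin (top_of_set S) U \<and> x \<in> U \<and>
      (\<forall>y\<in>U. insert (h x) (insert (h y) (supp (f y) \<union> supp (g y))) \<in> ?K)" if x: "x \<in> S" for x
  proof (intro exI conjI ballI)
    \<comment> \<open>The neighborhood is the ball that determines \<open>h x\<close>, so
      \<open>h x\<close> remains an active vertex at each of its points.\<close>
    let ?a = "SOME a. a \<in> N x" and ?U = "S \<inter> ball (SOME a. a \<in> N x) (r (SOME a. a \<in> N x))"
    have a: "?a \<in> N x"
      using N[OF x] by (simp add: some_in_eq)
    show "openin (top_of_set S) ?U"
      by (simp add: openin_open_Int)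
    show "x \<in> ?U"
      using a x by (auto simp: N_def)
    fix y assume y: "y \<in> ?U"
    then have "h x \<in> v ` N y"
      using a by (auto simp: h_def N_def)
    then show "insert (h x) (insert (h y) (supp (f y) \<union> supp (g y))) \<in> ?K"
      using y hN[of y] suppg[of y] clq[of y] by (auto elim: clique_complex_subset)
  qed
  \<comment> \<open>A ball around another centre has radius at most its distance to \<open>b\<close>
    and so misses \<open>b\<close>; since some ball contains \<open>b\<close>, it is the one centred
    there.\<close>
  have "N b = {b}"
  proof -
    have "a = b" if "a \<in> N b" for a
      using that rb[OF NC[OF that]] by (auto simp: N_def)
    then show ?thesis
      using N[OF \<open>b \<in> S\<close>] by blast
  qed
  then have "h b = v b" "supp (g b) = {v b}"
    using suppg[OF \<open>b \<in> S\<close>] by (auto simp: h_def)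
  then show thesis
    using that[of "v ` C" g h] C(2) cg gS suppg near v[OF \<open>b \<in> S\<close>]
    by (auto simp: N_def image_iff)
qed

text \<open>
  Where \<open>\<phi> \<ge> 1/2\<close>, the homotopy jumps at time \<open>1/2\<close> from \<open>f\<close> to \<open>g\<close>. Where \<open>\<phi> < 1/2\<close>, it moves linearly
  from \<open>f\<close> to \<open>g\<close>, during a time interval that shrinks to \<open>{1/2}\<close> as \<open>\<phi>\<close> approaches \<open>1/2\<close>.
\<close>

lemma blended_homotopy:
  fixes S :: "'b::metric_space set" and f g0 :: "'b \<Rightarrow> 'a \<Rightarrow> real" and \<phi> :: "'b \<Rightarrow> real"
  assumes f: "pcontinuous (pretop_of (top_of_set S)) (intermediate_realization X E) f"
    and F: "finite F"
    and g0c: "\<And>v. continuous_on S (\<lambda>x. g0 x v)"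
    and g0K: "\<And>x. x \<in> S \<Longrightarrow> g0 x \<in> geom_points (clique_complex X E)"
    and g0F: "\<And>x. x \<in> S \<Longrightarrow> supp (g0 x) \<subseteq> F"
    and near: "\<And>x. x \<in> S \<Longrightarrow> \<exists>U. openin (top_of_set S) U \<and> x \<in> U \<and>
       (\<forall>y\<in>U. insert (h x) (insert (h y) (supp (f y) \<union> supp (g0 y))) \<in> clique_complex X E)"
    and \<phi>: "continuous_on S \<phi>" "\<And>x. x \<in> S \<Longrightarrow> 0 \<le> \<phi> x"
    and fF: "\<And>x. x \<in> S \<Longrightarrow> \<phi> x < 2 \<Longrightarrow> supp (f x) \<subseteq> F"
    and fc: "\<And>v. continuous_on {x \<in> S. \<phi> x < 2} (\<lambda>x. f x v)"
  obtains g H where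
    "continuous_map (top_of_set S) (geom_realization (clique_complex X E)) g"
    "pcontinuous (pretop_of (top_of_set (S \<times> {0..1}))) (intermediate_realization X E) H"
    "\<And>x. x \<in> S \<Longrightarrow> H (x, 0) = f x"
    "\<And>x. x \<in> S \<Longrightarrow> H (x, 1) = g x"
    "\<And>x t. x \<in> S \<Longrightarrow> t \<in> {0..1::real} \<Longrightarrow>
       \<phi> x = 0 \<or> f x = indicator {h x} \<and> g0 x = indicator {h x} \<Longrightarrow> H (x, t) = f x"
proof -
  let ?K = "clique_complex X E" and ?R = "intermediate_realization X E"
  define L where "L x a = (\<lambda>v. (1 - a) * f x v + a * g0 x v)" for x and a :: real
  have fS: "f x \<in> geom_points ?K" if "x \<in> S" for x
    using f that by (auto simp: pcontinuous_from_topology)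
  have clq: "insert (h x) (supp (f x) \<union> supp (g0 x)) \<in> ?K" if "x \<in> S" for x
    using near[OF that] by auto
  have LK: "L x a \<in> geom_points ?K" "supp (L x a) \<subseteq> supp (f x) \<union> supp (g0 x)"
    if "x \<in> S" "a \<in> {0..1}" for x a
  proof -
    have "supp (f x) \<union> supp (g0 x) \<in> ?K"
      using supp_nonempty[OF fS[OF that(1)]] by (intro clique_complex_subset[OF clq[OF that(1)]]) auto
    with geom_points_convex_combination[OF fS g0K] that
    show "L x a \<in> geom_points ?K" "supp (L x a) \<subseteq> supp (f x) \<union> supp (g0 x)"
      by (auto simp: L_def)
  qed
  \<comment> \<open>Where \<phi> is below 2, the coordinates of \<open>f\<close> and
    \<open>g0\<close> are continuous and their carriers stay in the finite set \<open>F\<close>, so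
    interpolation is continuous even for the weak topology. The parameter space \<open>P\<close> is
    arbitrary because both \<open>g\<close> and the homotopy use this.\<close>
  have LC: "continuous_map (top_of_set P) (geom_realization ?K) (\<lambda>p. L (k p) (\<alpha> p))"
    if k: "continuous_on P k" "\<And>p. p \<in> P \<Longrightarrow> k p \<in> S \<and> \<phi> (k p) < 2"
      and \<alpha>: "continuous_on P \<alpha>" "\<And>p. p \<in> P \<Longrightarrow> \<alpha> p \<in> {0..1}"
    for P :: "'c::topological_space set" and k \<alpha>
  proof (rule continuous_map_into_geom_realization[OF F])
    fix p assume "p \<in> topspace (top_of_set P)"
    then have p: "p \<in> P" by simp
    show "L (k p) (\<alpha> p) \<in> geom_points ?K"
      using LK(1) k(2) \<alpha>(2) p by blast
    show "supp (L (k p) (\<alpha> p)) \<subseteq> F"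
      using LK(2)[of "k p" "\<alpha> p"] k(2)[OF p] \<alpha>(2)[OF p] fF[of "k p"] g0F[of "k p"] by blast
  next
    fix v
    have "continuous_on P (\<lambda>p. f (k p) v)"
      by (rule continuous_on_compose2[OF fc k(1)]) (use k(2) in auto)
    moreover have "continuous_on P (\<lambda>p. g0 (k p) v)"
      by (rule continuous_on_compose2[OF g0c k(1)]) (use k(2) in auto)
    ultimately show "continuous_map (top_of_set P) euclideanreal (\<lambda>p. L (k p) (\<alpha> p) v)"
      using \<alpha>(1) by (auto simp: L_def intro!: continuous_intros)
  qed
  have L01: "L x 0 = f x" "L x 1 = g0 x" for x
    by (simp_all add: L_def)
  \<comment> \<open>This is \<open>f\<close> where \<phi> vanishes, which fixes the base point, and
    \<open>g0\<close> where \<phi> is at least 1.\<close>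
  define g where "g x = L x (min 1 (\<phi> x))" for x
  have gR: "continuous_map (top_of_set S) (geom_realization ?K) g"
    unfolding pcontinuous_pretop_of_iff[symmetric] pcontinuous_from_topology
  proof (intro conjI ballI allI impI)
    show "g \<in> topspace (top_of_set S) \<rightarrow> points (pretop_of (geom_realization ?K))"
      using \<phi>(2) by (auto simp: g_def topspace_geom_realization intro!: LK)
    fix x P assume "x \<in> topspace (top_of_set S)" and P: "eventually P (nhood (pretop_of (geom_realization ?K)) (g x))"
    then have x: "x \<in> S" by simp
    show "\<exists>U. openin (top_of_set S) U \<and> x \<in> U \<and> (\<forall>y\<in>U. P (g y))"
    \<comment> \<open>The open sets given by \<phi> < 2 and \<phi> > 1 cover \<open>S\<close>.
      Interpolation is continuous on the first, and \<open>g\<close> equals \<open>g0\<close> on the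
      second.\<close>
    proof (cases "\<phi> x < 2")
      case True
      let ?U = "S \<inter> \<phi> -` {..<2}"
      have "continuous_map (top_of_set ?U) (geom_realization ?K) g"
        unfolding g_def using \<phi>
        by (intro LC) (auto intro!: continuous_intros intro: continuous_on_subset)
      moreover have "openin (top_of_set S) ?U"
        by (rule continuous_openin_preimage_gen[OF \<phi>(1)]) simp
      ultimately show ?thesis
        using x True
        by (intro pcontinuous_at_locally[of _ ?U x "clique_realization X E" g g P, OF _ _ _ _ P])
          (auto simp: subtopology_subtopology pcontinuous_pretop_of_iff)
    next
      case False
      let ?U = "S \<inter> \<phi> -` {1<..}"
      have "continuous_map (top_of_set ?U) (geom_realization ?K) g0"
        using g0F g0K continuous_on_subset[OF g0c]
        by (intro continuous_map_into_geom_realization[OF F]) auto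
      moreover have "openin (top_of_set S) ?U"
        by (rule continuous_openin_preimage_gen[OF \<phi>(1)]) simp
      moreover have "g y = g0 y" if "y \<in> ?U" for y
        using that by (simp add: g_def L01)
      ultimately show ?thesis
        using x False
        by (intro pcontinuous_at_locally[of _ ?U x "clique_realization X E" g0 g P, OF _ _ _ _ P])
          (auto simp: subtopology_subtopology pcontinuous_pretop_of_iff)
    qed
  qed
  let ?I = "S \<times> {0..1::real}"
  \<comment> \<open>The transition at \<open>x\<close> fills the times within \<open>m x\<close> of
    1/2. \<open>A\<close> is the time since its start and \<open>B\<close> the time until its end,
    both cut off at 0, so \<open>A / (A + B)\<close> rises from 0 to 1. Both vanish exactly at time
    1/2 where \<open>m x = 0\<close>.\<close>
  define m where "m x = max 0 (1 / 2 - \<phi> x)" for x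
  define A where "A p = max 0 (snd p - 1 / 2 + m (fst p))" for p :: "'b \<times> real"
  define B where "B p = max 0 (1 / 2 - snd p + m (fst p))" for p :: "'b \<times> real"
  \<comment> \<open>The second factor makes the transition end at \<open>g\<close> instead of
    \<open>g0\<close>.\<close>
  define \<alpha> where "\<alpha> p = A p / (A p + B p) * min 1 (\<phi> (fst p))" for p
  define H where "H p = (if A p + B p = 0 then indicator {h (fst p)} else L (fst p) (\<alpha> p))" for p
  have AB: "A p \<ge> 0" "B p \<ge> 0" for p
    by (simp_all add: A_def B_def)
  have \<phi>1: "continuous_on ?I (\<lambda>p. \<phi> (fst p))"
    by (rule continuous_on_compose2[OF \<phi>(1) continuous_on_fst]) (auto intro: continuous_intros)
  have ABc: "continuous_on ?I A" "continuous_on ?I B"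
    unfolding A_def B_def m_def by (intro continuous_intros \<phi>1)+
  have \<alpha>01: "\<alpha> p \<in> {0..1}" if "fst p \<in> S" for p
  proof -
    have "A p / (A p + B p) \<in> {0..1}"
      using AB[of p] by (auto simp: divide_le_eq_1)
    then show ?thesis
      using \<phi>(2)[OF that] unfolding \<alpha>_def atLeastAtMost_iff
      by (intro conjI mult_nonneg_nonneg mult_le_one) auto
  qed
  have HR: "pcontinuous (pretop_of (top_of_set ?I)) ?R H"
    unfolding pcontinuous_from_topology
  proof (intro conjI ballI allI impI)
    have "{h x} \<in> ?K" if "x \<in> S" for x
      by (rule clique_complex_subset[OF clq[OF that]]) auto
    then show "H \<in> topspace (top_of_set ?I) \<rightarrow> points ?R"
      using LK(1) \<alpha>01 by (auto simp: H_def intro!: geom_points_indicator)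
    fix p P assume "p \<in> topspace (top_of_set ?I)" and P: "eventually P (nhood ?R (H p))"
    then have p: "fst p \<in> S" "snd p \<in> {0..1}" by auto
    show "\<exists>U. openin (top_of_set ?I) U \<and> p \<in> U \<and> (\<forall>q\<in>U. P (H q))"
    proof (cases "A p + B p = 0")
      case True
      obtain U where U: "openin (top_of_set S) U" "fst p \<in> U"
        "\<forall>y\<in>U. insert (h (fst p)) (insert (h y) (supp (f y) \<union> supp (g0 y))) \<in> ?K"
        using near[OF p(1)] by blast
      have "h (fst p) \<in> X"
        using clq[OF p(1)] by (auto simp: clique_complex_def)
      then have *: "\<forall>t\<in>star X E (h (fst p)). P t"
        using P True by (simp add: H_def eventually_nhood_vertex)
      \<comment> \<open>At any time \<open>H q\<close> is the vertex \<open>h (fst q)\<close> or a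
        point of the segment from \<open>f\<close> to \<open>g0\<close>. In both cases its carrier
        lies in the clique \<open>c\<close>, which contains \<open>h (fst p)\<close>.\<close>
      have "H q \<in> star X E (h (fst p))" if q: "q \<in> U \<times> {0..1}" for q
      proof -
        have "fst q \<in> U" "fst q \<in> S"
          using q U(1) openin_imp_subset by fastforce+
        then have c: "insert (h (fst p)) (insert (h (fst q)) (supp (f (fst q)) \<union> supp (g0 (fst q)))) \<in> ?K"
          using U(3) by blast
        have "{h (fst q)} \<in> ?K" "{h (fst p), h (fst q)} \<in> ?K"
          by (rule clique_complex_subset[OF c]; auto)+
        moreover have "insert (h (fst p)) (supp (L (fst q) (\<alpha> q))) \<in> ?K"
          by (rule clique_complex_subset[OF c]) (use LK(2)[OF \<open>fst q \<in> S\<close> \<alpha>01[OF \<open>fst q \<in> S\<close>]] in auto)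
        ultimately show ?thesis
          using LK(1)[OF \<open>fst q \<in> S\<close> \<alpha>01[OF \<open>fst q \<in> S\<close>]]
          by (auto simp: star_def H_def intro: geom_points_indicator)
      qed
      moreover have "openin (top_of_set ?I) (U \<times> {0..1})"
        using U(1) by (intro openin_Times) auto
      ultimately show ?thesis
        using U(2) p * by (intro exI[of _ "U \<times> {0..1}"]) (auto simp: mem_Times_iff)
    next
      case AB0: False
      have pl: "\<exists>V. openin (top_of_set ?I) V \<and> p \<in> V \<and> (\<forall>y\<in>V. P (H y))"
        if "openin (top_of_set ?I) U" "p \<in> U" "pcontinuous (pretop_of (top_of_set U)) ?R f'"
          "\<And>y. y \<in> U \<Longrightarrow> H y = f' y" for U f'
      proof (rule pcontinuous_at_locally[of _ U p ?R f' H P, OF that(1,2) _ that(4) P])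
        show "pcontinuous (pretop_of (subtopology (top_of_set ?I) U)) ?R f'"
          using that(3) openin_imp_subset[OF that(1)] by (simp add: subtopology_subtopology Int_absorb1)
      qed
      show ?thesis
      \<comment> \<open>For \<phi> < 2 the interpolation is continuous where \<open>A + B\<close> is
        nonzero. Otherwise coordinates of \<open>f\<close> are not controlled, but nearby \<phi> > 1
        forces \<open>m\<close> to be 0, so the homotopy is \<open>f\<close> before time 1/2 and
        \<open>g\<close> after it.\<close>
      proof (cases "\<phi> (fst p) < 2")
        case True
        let ?U = "(?I \<inter> (\<lambda>p. \<phi> (fst p)) -` {..<2}) \<inter> (?I \<inter> (\<lambda>p. A p + B p) -` (- {0}))"
        have "continuous_on ?U \<alpha>"
          unfolding \<alpha>_def
          by (intro continuous_intros continuous_on_subset[OF ABc(1)] continuous_on_subset[OF ABc(2)]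
            continuous_on_subset[OF \<phi>1]) auto
        then have "continuous_map (top_of_set ?U) (geom_realization ?K) (\<lambda>p. L (fst p) (\<alpha> p))"
          using \<alpha>01 by (intro LC) (auto intro!: continuous_intros)
        then have "pcontinuous (pretop_of (top_of_set ?U)) ?R (\<lambda>p. L (fst p) (\<alpha> p))"
          by (rule pcontinuous_into_intermediate)
        moreover have "openin (top_of_set ?I) ?U"
          by (intro openin_Int continuous_openin_preimage_gen[OF \<phi>1]
              continuous_openin_preimage_gen[OF continuous_on_add[OF ABc]]) auto
        ultimately show ?thesis
          using p True AB0 by (intro pl[of ?U]) (auto simp: H_def mem_Times_iff)
      next
        case False
        then have "m (fst p) = 0"
          by (simp add: m_def)
        then have half: "snd p \<noteq> 1 / 2"
          using AB0 by (auto simp: A_def B_def)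
        have \<phi>_open: "openin (top_of_set ?I) (?I \<inter> (\<lambda>p. \<phi> (fst p)) -` {1<..})"
          by (rule continuous_openin_preimage_gen[OF \<phi>1]) simp
        have fst: "continuous_map (top_of_set U) (top_of_set S) fst" if "U \<subseteq> ?I" for U
          using that by (auto intro!: continuous_intros)
        show ?thesis
        proof (cases "snd p < 1 / 2")
          case True
          let ?U = "(?I \<inter> (\<lambda>p. \<phi> (fst p)) -` {1<..}) \<inter> (?I \<inter> snd -` {..<1 / 2})"
          have eq: "H q = (f \<circ> fst) q" if "q \<in> ?U" for q
          proof -
            have "A q = 0" "B q > 0"
              using that by (auto simp: A_def B_def m_def)
            then show ?thesis
              by (simp add: H_def \<alpha>_def L01)
          qed
          have cont: "pcontinuous (pretop_of (top_of_set ?U)) ?R (f \<circ> fst)"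
            by (rule pcontinuous_compose_map[OF fst f]) auto
          have "openin (top_of_set ?I) ?U"
            by (intro openin_Int \<phi>_open continuous_openin_preimage_gen[OF continuous_on_snd]) (auto intro: continuous_intros)
          then show ?thesis
            using p True False by (intro pl[OF _ _ cont eq]) (auto simp: mem_Times_iff)
        next
          case ge: False
          let ?U = "(?I \<inter> (\<lambda>p. \<phi> (fst p)) -` {1<..}) \<inter> (?I \<inter> snd -` {1 / 2<..})"
          have eq: "H q = (g \<circ> fst) q" if "q \<in> ?U" for q
          proof -
            have "B q = 0" "A q > 0"
              using that by (auto simp: A_def B_def m_def)
            then show ?thesis
              by (simp add: H_def \<alpha>_def g_def)
          qed
          have cont: "pcontinuous (pretop_of (top_of_set ?U)) ?R (g \<circ> fst)"
            by (rule pcontinuous_compose_map[OF fst pcontinuous_into_intermediate[OF gR]]) auto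
          have "openin (top_of_set ?I) ?U"
            by (intro openin_Int \<phi>_open continuous_openin_preimage_gen[OF continuous_on_snd]) (auto intro: continuous_intros)
          then show ?thesis
            using p half ge False by (intro pl[OF _ _ cont eq]) (auto simp: mem_Times_iff)
        qed
      qed
    qed
  qed
  \<comment> \<open>The upper bound keeps the transition inside the unit interval, so it has not yet
    advanced at time 0 and is complete at time 1.\<close>
  have m: "0 \<le> m x" "m x \<le> 1 / 2" if "x \<in> S" for x
    using \<phi>(2)[OF that] unfolding m_def by linarith+
  show thesis
  proof (rule that[OF gR HR])
    fix x assume x: "x \<in> S"
    have "A (x, 0) = 0" "B (x, 0) > 0" "A (x, 1) > 0" "B (x, 1) = 0"
      using m[OF x] by (auto simp: A_def B_def)
    then show "H (x, 0) = f x" "H (x, 1) = g x"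
      by (simp_all add: H_def \<alpha>_def g_def L01)
    fix t :: real
    assume "\<phi> x = 0 \<or> f x = indicator {h x} \<and> g0 x = indicator {h x}"
    then show "H (x, t) = f x"
    proof
      assume "\<phi> x = 0"
      then have "A (x, t) + B (x, t) \<noteq> 0" "\<alpha> (x, t) = 0"
        by (auto simp: A_def B_def m_def \<alpha>_def max_def)
      then show ?thesis
        by (simp add: H_def L01)
    next
      assume "f x = indicator {h x} \<and> g0 x = indicator {h x}"
      then show ?thesis
        by (auto simp: H_def L_def algebra_simps)
    qed
  qed
qed

section \<open>Surjectivity on homotopy classes\<close>

text \<open>The sphere is a closed subset of an infinite product of intervals, which is compact by
  Tychonoff.\<close>

lemma compact_nsphere: "compact (topspace (nsphere n))"
proof -
  have "topspace (nsphere n) = {x. (\<Sum>i\<le>n. (x i)\<^sup>2) = 1} \<inter> {x. \<forall>i. i > n \<longrightarrow> x i = 0}"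
    by (auto simp: topspace_nsphere_iff)
  moreover have "closed {x :: nat \<Rightarrow> real. i > n \<longrightarrow> x i = 0}" for i
    by (cases "i > n")
      (auto intro!: closed_Collect_eq continuous_on_const continuous_on_product_coordinates)
  moreover have "closed {x :: nat \<Rightarrow> real. (\<Sum>i\<le>n. (x i)\<^sup>2) = 1}"
    by (intro closed_Collect_eq continuous_on_const continuous_on_sum continuous_on_power
        continuous_on_product_coordinates)
  ultimately have "closed (topspace (nsphere n))"
    by (simp add: closed_Int closed_Collect_all)
  moreover have "compact (PiE UNIV (\<lambda>_. {-1..1}) :: (nat \<Rightarrow> real) set)"
    by (subst compactin_euclidean_iff[symmetric], subst euclidean_product_topology[symmetric])
      (simp only: compactin_PiE, simp)
  moreover have "topspace (nsphere n) \<subseteq> PiE UNIV (\<lambda>_. {-1..1})"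
    using nsphere_coordinate_le_1 by (auto simp: abs_le_iff minus_le_iff)
  ultimately show ?thesis
    by (metis compact_Int_closed inf.absorb2)
qed

text \<open>Only the cut-off \<phi> depends on the base point. At a vertex the jump is made
  everywhere, since \<open>f\<close>, \<open>g0\<close> and \<open>h\<close> agree there; at a
  nonvertex \<phi> is a multiple of the distance to the base point.\<close>

lemma based_homotopic_to_clique_realization:
  assumes f: "f \<in> based_maps n (intermediate_realization X E) p"
  obtains g where "g \<in> based_maps n (clique_realization X E) p"
    "(f, g) \<in> based_homotopy_rel n (intermediate_realization X E) p"
proof -
  let ?K = "clique_complex X E" and ?R = "intermediate_realization X E"
  define S where "S = topspace (nsphere n)"
  define b where "b = sphere_base"
  have S: "nsphere n = top_of_set S"
    by (simp add: S_def nsphere_top_of_set)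
  have "compact S" "b \<in> S"
    by (simp_all add: S_def b_def compact_nsphere sphere_base_in_nsphere)
  have fc: "pcontinuous (pretop_of (top_of_set S)) ?R f" and fb: "f b = p"
    using based_mapsD[OF f] by (auto simp: S b_def)
  have fS: "f x \<in> geom_points ?K" if "x \<in> S" for x
    using fc that by (auto simp: pcontinuous_from_topology)
  obtain F g0 h where F: "finite F" and g0c: "\<And>v. continuous_on S (\<lambda>x. g0 x v)"
    and g0K: "\<And>x. x \<in> S \<Longrightarrow> g0 x \<in> geom_points ?K" and g0F: "\<And>x. x \<in> S \<Longrightarrow> supp (g0 x) \<subseteq> F"
    and near: "\<And>x. x \<in> S \<Longrightarrow> \<exists>U. openin (top_of_set S) U \<and> x \<in> U \<and>
       (\<forall>y\<in>U. insert (h x) (insert (h y) (supp (f y) \<union> supp (g0 y))) \<in> ?K)"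
    and hb: "h b \<in> supp (f b)" and gb: "supp (g0 b) = {h b}"
    using vertex_approximation[OF \<open>compact S\<close> \<open>b \<in> S\<close> fc] by blast
  have "\<exists>\<phi> F'. continuous_on S \<phi> \<and> (\<forall>x\<in>S. 0 \<le> \<phi> x) \<and> finite F' \<and>
      (\<forall>x\<in>S. \<phi> x < 2 \<longrightarrow> supp (f x) \<subseteq> F') \<and> (\<forall>v. continuous_on {x \<in> S. \<phi> x < 2} (\<lambda>x. f x v)) \<and>
      (\<phi> b = (0::real) \<or> f b = indicator {h b} \<and> g0 b = indicator {h b})"
  proof (cases "\<exists>v. v \<in> X \<and> p = indicator {v}")
    case True
    then have "f b = indicator {h b}"
      using hb fb by auto
    moreover have "g0 b = indicator {h b}"
      using eq_indicator_if_supp[OF g0K[OF \<open>b \<in> S\<close>]] gb by auto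
    ultimately show ?thesis
      \<comment> \<open>The constant 2 makes the conditions on the region \<phi> < 2
        vacuous.\<close>
      by (intro exI[of _ "\<lambda>_. 2"] exI[of _ "{}"]) auto
  next
    case False
    have "p \<in> geom_points ?K"
      using fS[OF \<open>b \<in> S\<close>] fb by simp
    then obtain U where U: "openin (top_of_set S) U" "b \<in> U" "\<forall>y\<in>U. \<nexists>v. v \<in> X \<and> f y = indicator {v}"
      using fc \<open>b \<in> S\<close> eventually_nonvertex[OF _ False] fb
      unfolding pcontinuous_from_topology topspace_euclidean_subtopology by blast
    then obtain e where e: "e > 0" "ball b e \<inter> S \<subseteq> U"
      unfolding openin_contains_ball by blast
    \<comment> \<open>On \<open>Q\<close> the map \<open>f\<close> avoids the vertices, so it is
      continuous into the clique complex; compactness of \<open>Q\<close> then leaves only finitely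
      many vertices in the carriers of its values.\<close>
    define Q where "Q = S \<inter> cball b (e / 2)"
    have "compact Q"
      using \<open>compact S\<close> by (simp add: Q_def compact_Int_closed)
    have "Q \<subseteq> S"
      by (auto simp: Q_def)
    have "Q \<subseteq> U"
      using e by (auto simp: Q_def)
    have "pcontinuous (pretop_of (top_of_set Q)) ?R f"
      using pcontinuous_subtopology[OF fc, of Q] \<open>Q \<subseteq> S\<close>
      by (simp add: subtopology_subtopology Int_absorb1)
    moreover have "nhood ?R (f y) = nhood (clique_realization X E) (f y)" if "y \<in> Q" for y
      using U(3) \<open>Q \<subseteq> U\<close> that by (simp add: nhood_nonvertex subsetD)
    ultimately have fQ: "continuous_map (top_of_set Q) (geom_realization ?K) f"
      by (simp add: pcontinuous_from_topology topspace_geom_realization flip: pcontinuous_pretop_of_iff)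
    have "compactin (top_of_set Q) Q"
      using \<open>compact Q\<close> by (simp add: compactin_subtopology)
    then have fin: "finite (\<Union>t\<in>f ` Q. supp t)"
      by (intro finite_supp_compact[of X E] image_compactin[OF _ fQ])
    have cont: "continuous_on Q (\<lambda>x. f x v)" for v
      using continuous_map_compose[OF fQ continuous_map_geom_realization_coordinate[of _ v]]
      by (simp add: o_def)
    \<comment> \<open>Scaled so that \<phi> < 2 means distance below \<open>e / 2\<close>, that is,
      inside \<open>Q\<close>.\<close>
    define \<phi> where "\<phi> x = dist b x * 4 / e" for x
    have \<phi>Q: "x \<in> Q" if "x \<in> S" "\<phi> x < 2" for x
      using that e(1) by (simp add: \<phi>_def Q_def field_simps)
    show ?thesis
    proof (intro exI[of _ \<phi>] exI[of _ "\<Union>t\<in>f ` Q. supp t"] conjI ballI allI impI)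
      show "continuous_on S \<phi>"
        unfolding \<phi>_def using e(1) by (intro continuous_intros) auto
      show "continuous_on {x \<in> S. \<phi> x < 2} (\<lambda>x. f x v)" for v
        by (rule continuous_on_subset[OF cont]) (use \<phi>Q in auto)
    qed (use e(1) \<phi>Q fin in \<open>auto simp: \<phi>_def\<close>)
  qed
  then obtain \<phi> :: "(nat \<Rightarrow> real) \<Rightarrow> real" and F' where \<phi>: "continuous_on S \<phi>" "\<And>x. x \<in> S \<Longrightarrow> 0 \<le> \<phi> x" "finite F'"
    "\<And>x. x \<in> S \<Longrightarrow> \<phi> x < 2 \<Longrightarrow> supp (f x) \<subseteq> F'" "\<And>v. continuous_on {x \<in> S. \<phi> x < 2} (\<lambda>x. f x v)"
    "\<phi> b = 0 \<or> f b = indicator {h b} \<and> g0 b = indicator {h b}"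
    by blast
  have fin: "finite (F \<union> F')"
    using F \<phi>(3) by simp
  have g0FF: "\<And>x. x \<in> S \<Longrightarrow> supp (g0 x) \<subseteq> F \<union> F'"
    using g0F by blast
  have fFF: "\<And>x. x \<in> S \<Longrightarrow> \<phi> x < 2 \<Longrightarrow> supp (f x) \<subseteq> F \<union> F'"
    using \<phi>(4) by blast
  show thesis
  proof (rule blended_homotopy[of S X E f "F \<union> F'" g0 h \<phi>])
    fix g and H :: "(nat \<Rightarrow> real) \<times> real \<Rightarrow> 'a \<Rightarrow> real"
    assume g: "continuous_map (top_of_set S) (geom_realization ?K) g"
      and H: "pcontinuous (pretop_of (top_of_set (S \<times> {0..1}))) ?R H"
      "\<And>x. x \<in> S \<Longrightarrow> H (x, 0) = f x" "\<And>x. x \<in> S \<Longrightarrow> H (x, 1) = g x"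
      "\<And>x t. x \<in> S \<Longrightarrow> t \<in> {0..1} \<Longrightarrow>
         \<phi> x = 0 \<or> f x = indicator {h x} \<and> g0 x = indicator {h x} \<Longrightarrow> H (x, t) = f x"
    have Hb: "H (b, t) = p" if "t \<in> {0..1}" for t
      using H(4)[OF \<open>b \<in> S\<close> that \<phi>(6)] fb by simp
    show thesis
    proof (rule that)
      show "g \<in> based_maps n (clique_realization X E) p"
        using g H(3)[OF \<open>b \<in> S\<close>] Hb[of 1]
        by (simp add: based_maps_def S pcontinuous_pretop_of_iff b_def)
      show "(f, g) \<in> based_homotopy_rel n ?R p"
        by (rule based_homotopyI[of n ?R H]) (use H Hb in \<open>simp_all add: S b_def\<close>)
    qed
  qed (fact fc fin g0c g0K g0FF near \<phi> fFF)+
qed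

section \<open>The map induced by \<open>Id_KR\<close> on homotopy classes\<close>

lemma based_maps_clique_subset:
  "based_maps n (clique_realization X E) p \<subseteq> based_maps n (intermediate_realization X E) p"
  using pcontinuous_into_intermediate by (auto simp: based_maps_def pcontinuous_pretop_of_iff)

lemma based_homotopy_rel_clique_subset:
  "based_homotopy_rel n (clique_realization X E) p \<subseteq> based_homotopy_rel n (intermediate_realization X E) p"
proof clarify
  fix f g assume "(f, g) \<in> based_homotopy_rel n (clique_realization X E) p"
  then obtain H where H: "pcontinuous (pretop_of (cylinder n)) (clique_realization X E) H"
    "\<And>x. x \<in> topspace (nsphere n) \<Longrightarrow> H (x, 0) = f x"
    "\<And>x. x \<in> topspace (nsphere n) \<Longrightarrow> H (x, 1) = g x"
    "\<And>t. t \<in> {0..1} \<Longrightarrow> H (sphere_base, t) = p"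
    by (rule based_homotopyE) (rule that)
  from H(1) have "pcontinuous (pretop_of (cylinder n)) (intermediate_realization X E) H"
    by (simp add: pcontinuous_pretop_of_iff pcontinuous_into_intermediate)
  then show "(f, g) \<in> based_homotopy_rel n (intermediate_realization X E) p"
    by (rule based_homotopyI) (use H in auto)
qed

text \<open>Homotopies in the clique complex remain homotopies in the intermediate realization, so
  all members of the class have images homotopic to \<open>f\<close>.\<close>

lemma homotopy_map_Id_KR_class:
  assumes "f \<in> based_maps n (clique_realization X E) p"
  shows "homotopy_map n (intermediate_realization X E) p Id_KR
      (based_homotopy_rel n (clique_realization X E) p `` {f})
    = based_homotopy_rel n (intermediate_realization X E) p `` {f}"
proof -
  have "(f, f) \<in> based_homotopy_rel n (clique_realization X E) p"
    by (rule based_homotopy_refl[OF assms])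
  then show ?thesis
    using based_homotopy_rel_clique_subset[of n X E p]
    by (auto simp: homotopy_map_def Id_KR_def o_def Image_iff
        intro: based_homotopy_trans based_homotopy_sym)
qed

lemma homotopy_map_Id_KR_image:
  "homotopy_map n (intermediate_realization X E) p Id_KR ` homotopy_set n (clique_realization X E) p
     = homotopy_set n (intermediate_realization X E) p"
proof (intro equalityI subsetI)
  let ?K = "clique_realization X E" and ?R = "intermediate_realization X E"
  fix A assume "A \<in> homotopy_map n ?R p Id_KR ` homotopy_set n ?K p"
  then show "A \<in> homotopy_set n ?R p"
    using based_maps_clique_subset[of n X E p]
    by (auto simp: homotopy_set_def quotient_def homotopy_map_Id_KR_class)
next
  let ?K = "clique_realization X E" and ?R = "intermediate_realization X E"
  fix A assume "A \<in> homotopy_set n ?R p"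
  then obtain f where f: "f \<in> based_maps n ?R p" "A = based_homotopy_rel n ?R p `` {f}"
    by (auto simp: homotopy_set_def quotient_def)
  obtain g where g: "g \<in> based_maps n ?K p" "(f, g) \<in> based_homotopy_rel n ?R p"
    using based_homotopic_to_clique_realization[OF f(1)] by blast
  have "A = homotopy_map n ?R p Id_KR (based_homotopy_rel n ?K p `` {g})"
    using equiv_class_eq[OF equiv_based_homotopy g(2)] f(2) homotopy_map_Id_KR_class[OF g(1)] by simp
  moreover have "based_homotopy_rel n ?K p `` {g} \<in> homotopy_set n ?K p"
    using g(1) by (auto simp: homotopy_set_def quotient_def)
  ultimately show "A \<in> homotopy_map n ?R p Id_KR ` homotopy_set n ?K p"
    by blast
qed

text \<open>The product saturates the set of all concatenations of representatives. These are
  homotopic to each other, so a single concatenation determines the class.\<close>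

lemma homotopy_group_mult_class:
  assumes n: "n \<ge> 1" and f: "f \<in> based_maps n Z z" and g: "g \<in> based_maps n Z z"
  shows "(based_homotopy_rel n Z z `` {f}) \<otimes>\<^bsub>homotopy_group n Z z\<^esub> (based_homotopy_rel n Z z `` {g})
    = based_homotopy_rel n Z z `` {sphere_concat n f g}"
proof -
  let ?r = "based_homotopy_rel n Z z"
  have "(f, f) \<in> ?r" "(g, g) \<in> ?r"
    using f g by (simp_all add: based_homotopy_refl)
  then have "sphere_concat n f g \<in> {sphere_concat n f' g' | f' g'. f' \<in> ?r `` {f} \<and> g' \<in> ?r `` {g}}"
    by blast
  moreover have "(sphere_concat n f g, k) \<in> ?r"
    if "k \<in> {sphere_concat n f' g' | f' g'. f' \<in> ?r `` {f} \<and> g' \<in> ?r `` {g}}" for k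
    using that based_homotopy_concat[OF n] by auto
  ultimately have "?r `` {sphere_concat n f' g' | f' g'. f' \<in> ?r `` {f} \<and> g' \<in> ?r `` {g}}
      = ?r `` {sphere_concat n f g}"
    by (auto intro: based_homotopy_trans)
  then show ?thesis
    by (simp add: homotopy_group_def)
qed

text \<open>\<open>Id_KR\<close> leaves representatives unchanged, so both groups concatenate the
  very same maps; surjectivity is the image lemma above.\<close>

lemma homotopy_map_Id_KR_epi:
  assumes n: "n \<ge> 1"
  shows "homotopy_map n (intermediate_realization X E) p Id_KR
    \<in> epi (homotopy_group n (clique_realization X E) p)
          (homotopy_group n (intermediate_realization X E) p)"
proof -
  let ?K = "clique_realization X E" and ?R = "intermediate_realization X E"
  let ?h = "homotopy_map n ?R p Id_KR"
  have "?h (A \<otimes>\<^bsub>homotopy_group n ?K p\<^esub> B) = ?h A \<otimes>\<^bsub>homotopy_group n ?R p\<^esub> ?h B"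
    if A: "A \<in> homotopy_set n ?K p" and B: "B \<in> homotopy_set n ?K p" for A B
  proof -
    obtain f g where f: "f \<in> based_maps n ?K p" "A = based_homotopy_rel n ?K p `` {f}"
      and g: "g \<in> based_maps n ?K p" "B = based_homotopy_rel n ?K p `` {g}"
      using A B by (auto simp: homotopy_set_def quotient_def)
    have "sphere_concat n f g \<in> based_maps n ?K p"
      using based_homotopy_concat[OF n based_homotopy_refl[OF f(1)] based_homotopy_refl[OF g(1)]]
      by (simp add: based_homotopy_rel_def)
    moreover have "f \<in> based_maps n ?R p" "g \<in> based_maps n ?R p"
      using f(1) g(1) based_maps_clique_subset by blast+
    ultimately show ?thesis
      by (simp add: f g homotopy_group_mult_class[OF n] homotopy_map_Id_KR_class)
  qed
  moreover have "?h ` homotopy_set n ?K p = homotopy_set n ?R p"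
    by (rule homotopy_map_Id_KR_image)
  ultimately show ?thesis
    by (auto simp: epi_def hom_def homotopy_group_def)
qed

theorem theorem2p2:
  fixes X :: "'a set" and E :: "('a \<times> 'a) set"
  assumes "reflexive_graph X E"
  shows "(\<forall>n f. pcontinuous (Sphere n) (intermediate_realization X E) f \<longrightarrow>
           (\<exists>g. pcontinuous (Sphere n) (clique_realization X E) g \<and>
                phomotopic (Sphere n) (intermediate_realization X E) f (Id_KR \<circ> g)))
       \<and> (\<forall>p \<in> geom_points (clique_complex X E).
           homotopy_map 0 (intermediate_realization X E) p Id_KR ` homotopy_set 0 (clique_realization X E) p
             = homotopy_set 0 (intermediate_realization X E) p)
       \<and> (\<forall>n\<ge>1. \<forall>p \<in> geom_points (clique_complex X E).
           homotopy_map n (intermediate_realization X E) p Id_KR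
             \<in> epi (homotopy_group n (clique_realization X E) p)
                   (homotopy_group n (intermediate_realization X E) p))"
proof (intro conjI allI ballI impI)
  fix n f assume f: "pcontinuous (Sphere n) (intermediate_realization X E) f"
  \<comment> \<open>An unbased map is based at its own value at \<open>sphere_base\<close>, so the
    based result covers it.\<close>
  then have "f \<in> based_maps n (intermediate_realization X E) (f sphere_base)"
    by (simp add: based_maps_def)
  then obtain g where g: "g \<in> based_maps n (clique_realization X E) (f sphere_base)"
    "(f, g) \<in> based_homotopy_rel n (intermediate_realization X E) (f sphere_base)"
    by (rule based_homotopic_to_clique_realization)
  then have "phomotopic (Sphere n) (intermediate_realization X E) f (Id_KR \<circ> g)"
    by (auto simp: based_homotopy_rel_def based_maps_def phomotopic_def Id_KR_def o_def)
  with based_mapsD(1)[OF g(1)] show "\<exists>g. pcontinuous (Sphere n) (clique_realization X E) g \<and>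
      phomotopic (Sphere n) (intermediate_realization X E) f (Id_KR \<circ> g)"
    by blast
qed (simp_all add: homotopy_map_Id_KR_image homotopy_map_Id_KR_epi)

end
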